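(* Let $p$ be a prime, $q$ a power of $p$, and let $f\in\mathbb{Q}[x_1,\dots,x_n]$ be an increasing polynomial, i.e. $f(x_1,\dots,x_i+1,\dots,x_n)\ge f(x_1,\dots,x_i,\dots,x_n)$ for all $i$ and all $x_1,\dots,x_n\in\mathbb{Z}_{\ge 0}$. Let $d_1,\dots,d_n$ be positive integers. Then $$F(T) := \sum_{x_1,\dots,x_n\ge 0} q^{f(x_1,\dots,x_n)}\, T^{d_1x_1+\cdots+d_nx_n}$$ is $p$-adic meromorphic on $\mathbb{C}_p$. Furthermore, adjoining the poles of $F$ to $\mathbb{Q}_p$ creates a finite extension field of $\mathbb{Q}_p$. *)

theory Defs
  imports
    "HOL-Analysis.Analysis"
    "HOL-Library.Poly_Mapping"
    "HOL-Computational_Algebra.Computational_Algebra"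
begin

subsection \<open>Subfields and field extensions inside an ambient field\<close>

definition is_subfield :: "'a::field set \<Rightarrow> bool" where
  "is_subfield K \<longleftrightarrow>
     0 \<in> K \<and> 1 \<in> K \<and>
     (\<forall>x\<in>K. \<forall>y\<in>K. x + y \<in> K \<and> x * y \<in> K) \<and>
     (\<forall>x\<in>K. - x \<in> K \<and> inverse x \<in> K)"

definition adjoin :: "'a::field set \<Rightarrow> 'a set \<Rightarrow> 'a set" where
  "adjoin K S = \<Inter>{L. is_subfield L \<and> K \<subseteq> L \<and> S \<subseteq> L}"

definition finite_extension :: "'a::field set \<Rightarrow> 'a set \<Rightarrow> bool" where
  "finite_extension K L \<longleftrightarrow>
     is_subfield K \<and> is_subfield L \<and> K \<subseteq> L \<and>
     (\<exists>B. finite B \<and> B \<subseteq> L \<and>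
        (\<forall>y\<in>L. \<exists>c. (\<forall>b\<in>B. c b \<in> K) \<and> y = (\<Sum>b\<in>B. c b * b)))"

definition algebraic_over :: "'a::field set \<Rightarrow> 'a \<Rightarrow> bool" where
  "algebraic_over K x \<longleftrightarrow> (\<exists>P. P \<noteq> 0 \<and> (\<forall>i. coeff P i \<in> K) \<and> poly P x = 0)"


subsection \<open>The field of p-adic complex numbers\<close>

text \<open>
  Neither \<open>\<rat>\<^sub>p\<close> nor \<open>\<complex>\<^sub>p\<close> is available as a type. We say instead when a field, complete for the
  metric of an absolute value, is the completion of an algebraic closure of \<open>\<rat>\<^sub>p\<close>; this determines
  it up to isometric isomorphism. As the ambient field is complete, the topological closure of the
  prime field \<open>\<rat>\<close> is the completion of \<open>\<rat>\<close>, that is, \<open>\<rat>\<^sub>p\<close>.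
\<close>

definition Qp :: "'a::{field_char_0,complete_space} set" where
  "Qp = closure \<rat>"

definition Qp_alg :: "'a::{field_char_0,complete_space} set" where
  "Qp_alg = {x. algebraic_over Qp x}"

text \<open>
  The ultrametric inequality and \<open>\<bar>p\<bar> = 1/p\<close> force \<open>\<bar>m\<bar> = 1\<close> for every integer \<open>m\<close> prime to \<open>p\<close>, so
  the absolute value restricts to the normalised \<open>p\<close>-adic one on \<open>\<rat>\<close>.
\<close>

locale padic_complex_field =
  fixes p :: nat
    and absp :: "'a::{field_char_0,complete_space} \<Rightarrow> real"
  assumes prime_p: "prime p"
    and absp_nonneg: "absp x \<ge> 0"
    and absp_eq_0_iff: "absp x = 0 \<longleftrightarrow> x = 0"
    and absp_mult: "absp (x * y) = absp x * absp y"
    and absp_add: "absp (x + y) \<le> max (absp x) (absp y)"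
    and absp_p: "absp (of_nat p) = 1 / real p"
    and dist_absp: "dist x y = absp (x - y)"
    and Qp_alg_closed:
      "\<lbrakk>\<And>i. coeff P i \<in> (Qp_alg :: 'a set); degree P > 0\<rbrakk> \<Longrightarrow> \<exists>z\<in>Qp_alg. poly P z = 0"
    and Qp_alg_dense: "closure (Qp_alg :: 'a set) = UNIV"


subsection \<open>Entire and meromorphic power series\<close>

definition entire :: "'a::{field_char_0,complete_space} fps \<Rightarrow> bool" where
  "entire G \<longleftrightarrow> (\<forall>t. summable (\<lambda>k. fps_nth G k * t ^ k))"

definition fps_value :: "'a::{field_char_0,complete_space} fps \<Rightarrow> 'a \<Rightarrow> 'a" where
  "fps_value G t = suminf (\<lambda>k. fps_nth G k * t ^ k)"

text \<open>A power series is meromorphic on \<open>\<complex>\<^sub>p\<close> if it is the quotient of two entire power series.\<close>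

definition entire_quotient ::
    "'a::{field_char_0,complete_space} fps \<Rightarrow> 'a fps \<Rightarrow> 'a fps \<Rightarrow> bool" where
  "entire_quotient F G H \<longleftrightarrow> entire G \<and> entire H \<and> H \<noteq> 0 \<and> F * H = G"

definition padic_meromorphic :: "'a::{field_char_0,complete_space} fps \<Rightarrow> bool" where
  "padic_meromorphic F \<longleftrightarrow> (\<exists>G H. entire_quotient F G H)"

text \<open>
  Common zeros of numerator and denominator can be divided out at any given point, so a pole is
  a point at which, for some representation, the denominator vanishes and the numerator does not.
\<close>

definition poles :: "'a::{field_char_0,complete_space} fps \<Rightarrow> 'a set" where
  "poles F = {a. \<exists>G H. entire_quotient F G H \<and> fps_value H a = 0 \<and> fps_value G a \<noteq> 0}"


subsection \<open>Increasing polynomials and their generating series\<close>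

text \<open>
  A polynomial in the variables \<open>x\<^sub>0, x\<^sub>1, \<dots>\<close> maps exponent vectors to coefficients; it lies in
  \<open>\<rat>[x\<^sub>0, \<dots>, x\<^sub>n\<^sub>-\<^sub>1]\<close> if all its monomials involve only variables with index below \<open>n\<close>.
\<close>

type_synonym rat_mpoly = "(nat \<Rightarrow>\<^sub>0 nat) \<Rightarrow>\<^sub>0 rat"

definition in_vars :: "nat \<Rightarrow> rat_mpoly \<Rightarrow> bool" where
  "in_vars n f \<longleftrightarrow> (\<forall>m\<in>Poly_Mapping.keys f. Poly_Mapping.keys m \<subseteq> {..<n})"

definition mpoly_eval :: "rat_mpoly \<Rightarrow> (nat \<Rightarrow> nat) \<Rightarrow> rat" where
  "mpoly_eval f x =
     (\<Sum>m\<in>Poly_Mapping.keys f. Poly_Mapping.lookup f m *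
        (\<Prod>i\<in>Poly_Mapping.keys m. of_nat (x i) ^ Poly_Mapping.lookup m i))"

text \<open>\<open>\<int>\<^bsub>\<ge>0\<^esub>\<^sup>n\<close>, with vectors extended by zero.\<close>

definition nat_vectors :: "nat \<Rightarrow> (nat \<Rightarrow> nat) set" where
  "nat_vectors n = {x. \<forall>i\<ge>n. x i = 0}"

definition increasing_poly :: "nat \<Rightarrow> rat_mpoly \<Rightarrow> bool" where
  "increasing_poly n f \<longleftrightarrow>
     (\<forall>x\<in>nat_vectors n. \<forall>i<n. mpoly_eval f (x(i := x i + 1)) \<ge> mpoly_eval f x)"

text \<open>
  The values of a polynomial with rational coefficients need not be integers, so \<open>q\<^sup>f\<close> depends on
  a compatible choice of rational powers of \<open>q\<close>, that is, a homomorphism from \<open>(\<rat>, +)\<close> to the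
  multiplicative group sending \<open>1\<close> to \<open>q\<close>. At integers such powers are the usual ones.
\<close>

definition rational_powers :: "'a::field \<Rightarrow> (rat \<Rightarrow> 'a) \<Rightarrow> bool" where
  "rational_powers q pw \<longleftrightarrow> pw 1 = q \<and> (\<forall>a b. pw (a + b) = pw a * pw b)"

lemma rational_powers_of_int:
  assumes "rational_powers q pw" and "q \<noteq> 0"
  shows "pw (of_int k) = q powi k"
proof -
  have add: "pw (a + b) = pw a * pw b" and one: "pw 1 = q" for a b
    using assms(1) by (auto simp: rational_powers_def)
  have "pw 1 = pw 1 * pw 0"
    using add[of 1 0] by simp
  then have zero: "pw 0 = 1"
    using one assms(2) by simp
  have nat: "pw (of_nat n) = q ^ n" for n
    by (induction n) (simp_all add: zero add one)
  have "pw (- of_nat n) * pw (of_nat n) = 1" for n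
    using add[of "- of_nat n" "of_nat n"] zero by simp
  then have neg: "pw (- of_nat n) = inverse (q ^ n)" for n
    by (metis nat inverse_unique mult.commute)
  show ?thesis
    by (cases k rule: int_cases2) (simp_all add: nat neg power_int_minus)
qed

text \<open>
  The terms of equal degree in \<open>T\<close> are collected. For positive weights there are only finitely many.
\<close>

definition gen_series ::
    "(rat \<Rightarrow> 'a::field) \<Rightarrow> nat \<Rightarrow> rat_mpoly \<Rightarrow> (nat \<Rightarrow> nat) \<Rightarrow> 'a fps" where
  "gen_series pw n f d =
     Abs_fps (\<lambda>m. \<Sum>x\<in>{x\<in>nat_vectors n. (\<Sum>i<n. d i * x i) = m}. pw (mpoly_eval f x))"

lemma finite_gen_series_index:
  assumes "\<And>i. i < n \<Longrightarrow> d i > 0"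
  shows "finite {x\<in>nat_vectors n. (\<Sum>i<n. d i * x i) = (m::nat)}"
proof (rule finite_subset)
  show "finite {x. \<forall>i. (i \<in> {..<n} \<longrightarrow> x i \<in> {..m}) \<and> (i \<notin> {..<n} \<longrightarrow> x i = 0)}"
    by (rule finite_set_of_finite_funs) auto
  show "{x\<in>nat_vectors n. (\<Sum>i<n. d i * x i) = m}
      \<subseteq> {x. \<forall>i. (i \<in> {..<n} \<longrightarrow> x i \<in> {..m}) \<and> (i \<notin> {..<n} \<longrightarrow> x i = 0)}"
  proof clarsimp
    fix x i
    assume x: "x \<in> nat_vectors n" and m: "m = (\<Sum>i<n. d i * x i)"
    have "x i \<le> (\<Sum>i<n. d i * x i)" if "i < n"
    proof -
      have "x i \<le> d i * x i" using assms[OF that] by simp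
      also have "\<dots> \<le> (\<Sum>i<n. d i * x i)"
        using that by (intro member_le_sum) auto
      finally show ?thesis .
    qed
    then show "(i < n \<longrightarrow> x i \<le> (\<Sum>i<n. d i * x i)) \<and> (\<not> i < n \<longrightarrow> x i = 0)"
      using x by (auto simp: nat_vectors_def)
  qed
qed

end

theory Submission imports Defs begin

text \<open>
  With a common denominator \<open>N\<close> of \<open>f\<close> and \<open>\<pi> = q\<^bsup>1/N\<^esup>\<close>, the terms of \<open>F\<close> are, up to one constant factor,
  \<open>\<pi>\<^bsup>g(x)\<^esup> T\<^bsup>d\<cdot>x\<^esup>\<close> with \<open>g = N (f - f(0))\<close> increasing, polynomial on every axis-parallel line and with
  values in \<open>\<nat>\<close>. Let \<open>H\<close> be the entire product of the factors \<open>1 - \<pi>\<^sup>m T\<^bsup>d\<^sub>i\<^esup>\<close> over all \<open>i\<close> and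
  \<open>m \<ge> 0\<close>. Then \<open>F H\<close> is entire, by induction on the number of variables: for every radius,

  \<^item> if \<open>g\<close> has a constant slope \<open>s\<close> in some variable \<open>x\<^sub>i\<close>, summing the geometric series over \<open>x\<^sub>i\<close>
    leaves a series in the remaining variables, divided by \<open>1 - \<pi>\<^sup>s T\<^bsup>d\<^sub>i\<^esup>\<close>;
  \<^item> otherwise for each \<open>i\<close> and \<open>C\<close> there is a line in direction \<open>x\<^sub>i\<close> on which \<open>g\<close> eventually exceeds
    \<open>C x\<^sub>i\<close>. As \<open>g\<close> increases, \<open>g(x) \<ge> C (d\<cdot>x)\<close> as soon as all \<open>x\<^sub>i\<close> are large, and the part of the
    sum where some \<open>x\<^sub>i\<close> is bounded consists of finitely many series in fewer variables.

  Hence every pole \<open>a\<close> satisfies \<open>\<pi>\<^sup>m a\<^bsup>d\<^sub>i\<^esup> = 1\<close> for some \<open>i\<close> and \<open>m\<close>. Multiplying \<open>a\<close> by a power of \<open>\<pi>\<close>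
  reduces \<open>m\<close> modulo \<open>d\<^sub>i\<close>, so the poles lie in the field generated by \<open>\<pi>\<close> and finitely many other
  elements, each with a power in \<open>\<rat>\<^sub>p\<close>.
\<close>

subsection \<open>Finite extensions inside an ambient field\<close>

text \<open>Lists are used so that the recursion removes one generator at a time and the length can
  be minimised. Repeated generators are allowed.\<close>

fun lin_span :: "'a::field set \<Rightarrow> 'a list \<Rightarrow> 'a set" where
  "lin_span K [] = {0}"
| "lin_span K (b # bs) = {c * b + v | c v. c \<in> K \<and> v \<in> lin_span K bs}"

lemma lin_span_ConsI:
  "x = c * b + v \<Longrightarrow> c \<in> K \<Longrightarrow> v \<in> lin_span K bs \<Longrightarrow> x \<in> lin_span K (b # bs)"
  by auto

definition lin_closed :: "'a::field set \<Rightarrow> 'a set \<Rightarrow> bool" where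
  "lin_closed K V \<longleftrightarrow> 0 \<in> V \<and> (\<forall>x\<in>V. \<forall>y\<in>V. x + y \<in> V) \<and> (\<forall>c\<in>K. \<forall>x\<in>V. c * x \<in> V)"

lemma is_subfieldD:
  assumes "is_subfield K"
  shows "0 \<in> K" "1 \<in> K" "x \<in> K \<Longrightarrow> y \<in> K \<Longrightarrow> x + y \<in> K" "x \<in> K \<Longrightarrow> y \<in> K \<Longrightarrow> x * y \<in> K"
    "x \<in> K \<Longrightarrow> - x \<in> K" "x \<in> K \<Longrightarrow> inverse x \<in> K"
  using assms by (auto simp: is_subfield_def)

lemma is_subfield_power: "is_subfield K \<Longrightarrow> x \<in> K \<Longrightarrow> x ^ j \<in> K"
  by (induction j) (auto intro: is_subfieldD)

lemma lin_closedD: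
  assumes "lin_closed K V"
  shows "0 \<in> V" "x \<in> V \<Longrightarrow> y \<in> V \<Longrightarrow> x + y \<in> V" "c \<in> K \<Longrightarrow> x \<in> V \<Longrightarrow> c * x \<in> V"
  using assms by (auto simp: lin_closed_def)

lemma lin_closed_subfield:
  assumes "is_subfield L" "K \<subseteq> L" shows "lin_closed K L"
  using assms unfolding is_subfield_def lin_closed_def by blast

lemma lin_closed_lin_span:
  assumes "is_subfield K" shows "lin_closed K (lin_span K bs)"
proof (induction bs)
  case Nil
  show ?case by (simp add: lin_closed_def)
next
  case (Cons b bs)
  note K = is_subfieldD[OF assms] and V = lin_closedD[OF Cons]
  show ?case
    unfolding lin_closed_def
  proof (intro conjI ballI)
    show "0 \<in> lin_span K (b # bs)"
      using K(1) V(1) by (intro lin_span_ConsI[of _ 0 _ 0]) auto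
  next
    fix x y assume "x \<in> lin_span K (b # bs)" "y \<in> lin_span K (b # bs)"
    then obtain c v c' v' where "x = c * b + v" "y = c' * b + v'"
      and *: "c \<in> K" "c' \<in> K" "v \<in> lin_span K bs" "v' \<in> lin_span K bs"
      by auto
    then have "x + y = (c + c') * b + (v + v')" by (simp add: algebra_simps)
    then show "x + y \<in> lin_span K (b # bs)" by (rule lin_span_ConsI) (use * K(3) V(2) in auto)
  next
    fix a x assume a: "a \<in> K" and "x \<in> lin_span K (b # bs)"
    then obtain c v where "x = c * b + v" and *: "c \<in> K" "v \<in> lin_span K bs" by auto
    then have "a * x = (a * c) * b + a * v" by (simp add: algebra_simps)
    then show "a * x \<in> lin_span K (b # bs)" by (rule lin_span_ConsI) (use * K(4) V(3) a in auto)
  qed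
qed

lemma lin_span_subset_Cons:
  assumes "is_subfield K" shows "lin_span K bs \<subseteq> lin_span K (b # bs)"
  using is_subfieldD(1)[OF assms] by (intro subsetI lin_span_ConsI[of _ 0]) auto

lemma set_subset_lin_span:
  assumes "is_subfield K" shows "set bs \<subseteq> lin_span K bs"
proof (induction bs)
  case (Cons b bs)
  have "b \<in> lin_span K (b # bs)"
    using is_subfieldD(2)[OF assms] lin_closedD(1)[OF lin_closed_lin_span[OF assms]]
    by (intro lin_span_ConsI[of _ 1 _ 0]) auto
  then show ?case using Cons lin_span_subset_Cons[OF assms] by fastforce
qed simp

lemma lin_span_least:
  assumes "lin_closed K V" "set bs \<subseteq> V" shows "lin_span K bs \<subseteq> V"
  using assms(2) by (induction bs) (auto intro: lin_closedD[OF assms(1)])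

lemma lin_span_scale: "lin_span K (map ((*) y) bs) = (*) y ` lin_span K bs"
proof (induction bs)
  case (Cons b bs)
  have "c * (y * b) + y * v = y * (c * b + v)" for c v
    by (simp add: algebra_simps)
  then have "{c * (y * b) + w | c w. c \<in> K \<and> w \<in> (*) y ` lin_span K bs}
      = (*) y ` {c * b + v | c v. c \<in> K \<and> v \<in> lin_span K bs}"
    unfolding image_def by (auto; metis)
  then show ?case by (simp add: Cons)
qed simp

text \<open>This passes from lists to the shape demanded by \<open>finite_extension\<close>, where
  coefficients are indexed by the elements of a set.\<close>

lemma lin_span_eq_sum:
  assumes "is_subfield K" "y \<in> lin_span K bs"
  shows "\<exists>c. (\<forall>b\<in>set bs. c b \<in> K) \<and> y = (\<Sum>b\<in>set bs. c b * b)"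
  using assms(2)
proof (induction bs arbitrary: y)
  case (Cons b bs)
  then obtain a v where y: "y = a * b + v" and a: "a \<in> K" and "v \<in> lin_span K bs" by auto
  then obtain c where c: "\<forall>b\<in>set bs. c b \<in> K" and v: "v = (\<Sum>b\<in>set bs. c b * b)"
    using Cons.IH by blast
  note K = is_subfieldD[OF assms(1)]
  show ?case
  proof (cases "b \<in> set bs")
    case True
    \<comment> \<open>A repeated generator occurs only once in the set, so its new coefficient is
      added to the old one.\<close>
    have "y = (\<Sum>x\<in>set (b # bs). (c x + (if x = b then a else 0)) * x)"
      using True
      by (simp add: y v insert_absorb distrib_right sum.distrib if_distrib[of "\<lambda>z. z * _"] cong: if_cong)
    moreover have "\<forall>x\<in>set (b # bs). c x + (if x = b then a else 0) \<in> K"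
      using c a True K(1,3) by auto
    ultimately show ?thesis by (intro exI[of _ "\<lambda>x. c x + (if x = b then a else 0)"]) simp
  next
    case False
    then have "y = (\<Sum>x\<in>set (b # bs). (c(b := a)) x * x)"
      by (auto simp: y v intro!: sum.cong)
    then show ?thesis using c a by (intro exI[of _ "c(b := a)"]) auto
  qed
qed simp

text \<open>An exchange argument by induction on the generators. If \<open>W\<close> is not inside
  the span of \<open>bs\<close>, some \<open>v\<close> in \<open>W\<close> has a nonzero coefficient
  at \<open>b\<close>, and \<open>W\<close> is generated by \<open>v\<close> and the intersection
  \<open>W0\<close> of \<open>W\<close> with that span. If \<open>W0\<close> is the whole span then
  \<open>b\<close> lies in \<open>W\<close> and nothing is lost; otherwise \<open>W0\<close> has a
  shorter list of generators.\<close>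

lemma lin_closed_subset_lin_span:
  assumes "is_subfield K" "lin_closed K W" "W \<subseteq> lin_span K bs"
  shows "W = lin_span K bs \<or> (\<exists>ws. W = lin_span K ws \<and> length ws < length bs)"
  using assms(2,3)
proof (induction bs arbitrary: W)
  case Nil
  then show ?case using lin_closedD(1)[OF Nil(1)] by auto
next
  case (Cons b bs)
  note K = is_subfieldD[OF assms(1)] and W = lin_closedD[OF Cons.prems(1)]
  note B = lin_closedD[OF lin_closed_lin_span[OF assms(1), of bs]]
  show ?case
  proof (cases "W \<subseteq> lin_span K bs")
    case True
    from Cons.IH[OF Cons.prems(1) True] show ?thesis by (auto simp: less_Suc_eq)
  next
    case False
    then obtain v where v: "v \<in> W" "v \<notin> lin_span K bs" by blast
    then obtain c u where vc: "v = c * b + u" and c: "c \<in> K" and u: "u \<in> lin_span K bs"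
      using Cons.prems(2) by auto
    have c0: "c \<noteq> 0" using v(2) vc u by auto
    define W0 where "W0 = W \<inter> lin_span K bs"
    have "lin_closed K W0"
      using W B unfolding W0_def lin_closed_def by blast
    from Cons.IH[OF this] have "W0 = lin_span K bs \<or> (\<exists>ws. W0 = lin_span K ws \<and> length ws < length bs)"
      by (simp add: W0_def)
    moreover have W0: "W = {a * v + w | a w. a \<in> K \<and> w \<in> W0}"
    proof (intro equalityI subsetI)
      fix x assume x: "x \<in> W"
      then obtain a w where xa: "x = a * b + w" and a: "a \<in> K" and w: "w \<in> lin_span K bs"
        using Cons.prems(2) by auto
      \<comment> \<open>Subtracting \<open>e * v\<close> from \<open>x\<close> cancels the
        coefficient at \<open>b\<close>.\<close>
      define e where "e = a * inverse c"
      have e: "e \<in> K" using a c K by (simp add: e_def)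
      have "x + (- e) * v = w + (- e) * u"
        using c0 by (simp add: xa vc e_def algebra_simps)
      moreover have "x + (- e) * v \<in> W" using x v(1) e K(5) W by blast
      moreover have "w + (- e) * u \<in> lin_span K bs" using w u e K(5) B by blast
      ultimately have "x + (- e) * v \<in> W0" by (simp add: W0_def)
      moreover have "x = e * v + (x + (- e) * v)" by simp
      ultimately show "x \<in> {a * v + w | a w. a \<in> K \<and> w \<in> W0}" using e by blast
    qed (use v(1) W in \<open>auto simp: W0_def\<close>)
    ultimately show ?thesis
    proof (elim disjE exE conjE)
      assume eq: "W0 = lin_span K bs"
      have "b = inverse c * v + (- inverse c) * u"
        using c0 by (simp add: vc algebra_simps)
      moreover have "inverse c * v \<in> W" "(- inverse c) * u \<in> W"
        using v(1) u c K(5,6) W(3) eq W0_def by blast+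
      ultimately have "b \<in> W" using W(2) by metis
      then have "lin_span K (b # bs) \<subseteq> W"
      proof (intro lin_span_least Cons.prems(1))
        have "set bs \<subseteq> W" using set_subset_lin_span[OF assms(1), of bs] eq by (auto simp: W0_def)
        then show "set (b # bs) \<subseteq> W" using \<open>b \<in> W\<close> by simp
      qed
      then show ?thesis using Cons.prems(2) by blast
    next
      fix ws assume "W0 = lin_span K ws" "length ws < length bs"
      then have "W = lin_span K (v # ws) \<and> length (v # ws) < length (b # bs)" using W0 by simp
      then show ?thesis by blast
    qed
  qed
qed

text \<open>Multiplication by a nonzero \<open>y\<close> preserves the least number of generators, so \<open>y V\<close> cannot be
  a proper subspace of \<open>V\<close>.\<close>

lemma is_subfield_lin_span:
  assumes K: "is_subfield K" and one: "1 \<in> lin_span K bs"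
    and mult: "\<And>x y. x \<in> lin_span K bs \<Longrightarrow> y \<in> lin_span K bs \<Longrightarrow> x * y \<in> lin_span K bs"
  shows "is_subfield (lin_span K bs)"
proof -
  define V where "V = lin_span K bs"
  note V = lin_closedD[OF lin_closed_lin_span[OF K, of bs], folded V_def]
  obtain cs where cs: "V = lin_span K cs" and min: "\<And>ws. V = lin_span K ws \<Longrightarrow> length cs \<le> length ws"
    using ex_has_least_nat[of "\<lambda>ws. V = lin_span K ws" bs length] by (auto simp: V_def)
  have "inverse y \<in> V" if y: "y \<in> V" for y
  proof (cases "y = 0")
    case False
    let ?W = "lin_span K (map ((*) y) cs)"
    have W: "?W = (*) y ` V" by (simp add: lin_span_scale cs)
    have "?W \<subseteq> lin_span K cs" using W mult[folded V_def] y cs by auto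
    from lin_closed_subset_lin_span[OF K lin_closed_lin_span[OF K] this]
    have "?W = V"
    proof (elim disjE exE conjE)
      fix ws assume ws: "?W = lin_span K ws" "length ws < length cs"
      have "(*) (inverse y) ` (*) y ` V = V" using False by (simp add: image_image mult.assoc[symmetric])
      then have "V = lin_span K (map ((*) (inverse y)) ws)"
        using W ws(1) by (simp add: lin_span_scale)
      from min[OF this] show ?thesis using ws(2) by simp
    qed (simp add: cs)
    moreover have "1 \<in> V" using one by (simp add: V_def)
    ultimately have "1 \<in> (*) y ` V" using W by simp
    then obtain z where "z \<in> V" "1 = y * z" by blast
    then show ?thesis using inverse_unique by metis
  qed (use y in simp)
  moreover have "- x \<in> V" if "x \<in> V" for x
    using V(3)[of "- 1" x] that is_subfieldD(2,5)[OF K] by simp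
  ultimately show ?thesis
    using V(1,2) one mult by (simp add: V_def is_subfield_def)
qed

text \<open>The products of the old generators with \<alpha>^j for j < e span a ring, because
  \<alpha>^e lies in \<open>K\<close>. A ring that is a finite span is a field by
  \<open>is_subfield_lin_span\<close>.\<close>

lemma adjoin_root_lin_span:
  assumes K: "is_subfield K" and L: "is_subfield (lin_span K bs)" and KL: "K \<subseteq> lin_span K bs"
    and e: "0 < e" and \<alpha>: "\<alpha> ^ e \<in> K"
  obtains cs where "is_subfield (lin_span K cs)" "lin_span K bs \<subseteq> lin_span K cs" "\<alpha> \<in> lin_span K cs"
proof -
  define cs where "cs = concat (map (\<lambda>j. map (\<lambda>b. b * \<alpha> ^ j) bs) [0..<e])"
  note C = lin_closedD[OF lin_closed_lin_span[OF K, of cs]]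
  have low: "v * \<alpha> ^ j \<in> lin_span K cs" if "j < e" "v \<in> lin_span K bs" for v j
  proof -
    have "lin_closed K {v. v * \<alpha> ^ j \<in> lin_span K cs}"
      using C by (auto simp: lin_closed_def distrib_right mult.assoc)
    moreover have "set bs \<subseteq> {v. v * \<alpha> ^ j \<in> lin_span K cs}"
    proof
      fix b assume "b \<in> set bs"
      then have "b * \<alpha> ^ j \<in> set cs" using that(1) by (auto simp: cs_def)
      then show "b \<in> {v. v * \<alpha> ^ j \<in> lin_span K cs}" using set_subset_lin_span[OF K, of cs] by blast
    qed
    ultimately show ?thesis using lin_span_least that(2) by blast
  qed
  have all: "v * \<alpha> ^ j \<in> lin_span K cs" if "v \<in> lin_span K bs" for v j
  proof -
    \<comment> \<open>The exponent is reduced modulo \<open>e\<close>; the remaining power of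
      \<alpha>^e is a scalar.\<close>
    have "v * \<alpha> ^ j = v * (\<alpha> ^ e) ^ (j div e) * \<alpha> ^ (j mod e)"
      by (metis mult.assoc mult_div_mod_eq power_add power_mult)
    moreover have "v * (\<alpha> ^ e) ^ (j div e) \<in> lin_span K bs"
      using that is_subfield_power[OF K \<alpha>] KL is_subfieldD(4)[OF L] by blast
    ultimately show ?thesis using low[of "j mod e"] e by (metis mod_less_divisor)
  qed
  have one: "1 \<in> lin_span K bs" using L by (rule is_subfieldD)
  \<comment> \<open>Closure under products is checked on generators and then extended one factor at
    a time, since for a fixed other factor the admissible elements form a subspace.\<close>
  have gen: "x * y \<in> lin_span K cs" if x: "x \<in> set cs" and y: "y \<in> set cs" for x y
  proof -
    obtain b j b' j' where "b \<in> set bs" "b' \<in> set bs" and xy: "x = b * \<alpha> ^ j" "y = b' * \<alpha> ^ j'"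
      using x y by (auto simp: cs_def)
    then have "b * b' \<in> lin_span K bs"
      using set_subset_lin_span[OF K] is_subfieldD(4)[OF L] by blast
    from all[OF this, of "j + j'"] show ?thesis by (simp add: xy power_add mult_ac)
  qed
  have left: "x * y \<in> lin_span K cs" if x: "x \<in> set cs" and y: "y \<in> lin_span K cs" for x y
  proof -
    have "lin_closed K {y. x * y \<in> lin_span K cs}"
      using C by (auto simp: lin_closed_def distrib_left mult.left_commute)
    then show ?thesis using lin_span_least[of K _ cs] gen[OF x] y by blast
  qed
  have "x * y \<in> lin_span K cs" if x: "x \<in> lin_span K cs" and y: "y \<in> lin_span K cs" for x y
  proof -
    have "lin_closed K {x. x * y \<in> lin_span K cs}"
      using C by (auto simp: lin_closed_def distrib_right mult.assoc)
    then show ?thesis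
      using lin_span_least[of K _ cs] left x y by blast
  qed
  moreover have "1 \<in> lin_span K cs" using all[OF one, of 0] by simp
  ultimately have "is_subfield (lin_span K cs)" by (intro is_subfield_lin_span K)
  moreover have "lin_span K bs \<subseteq> lin_span K cs" using all[of _ 0] by auto
  moreover have "\<alpha> \<in> lin_span K cs" using all[OF one, of 1] by simp
  ultimately show thesis using that by blast
qed

text \<open>The set \<open>P\<close> may be infinite: it only has to lie in every field containing
  \<open>K\<close> and the finitely many radicals \<open>A\<close>. Adjoining \<open>A\<close> step
  by step gives a finite span that is a field; \<open>adjoin K P\<close> is a subspace of it, hence
  itself a finite span.\<close>

lemma finite_extension_adjoin_radicals:
  assumes K: "is_subfield K" and fin: "finite A"
    and rad: "\<And>a. a \<in> A \<Longrightarrow> \<exists>e>0. a ^ e \<in> K"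
    and P: "\<And>L. is_subfield L \<Longrightarrow> K \<subseteq> L \<Longrightarrow> A \<subseteq> L \<Longrightarrow> P \<subseteq> L"
  shows "finite_extension K (adjoin K P)"
proof -
  have "\<exists>bs. is_subfield (lin_span K bs) \<and> K \<subseteq> lin_span K bs \<and> A \<subseteq> lin_span K bs"
    using fin rad
  proof (induction A)
    case empty
    have "lin_span K [1] = K" by simp
    then show ?case using K by (intro exI[of _ "[1]"]) simp
  next
    case (insert a A)
    then obtain bs where bs: "is_subfield (lin_span K bs)" "K \<subseteq> lin_span K bs" "A \<subseteq> lin_span K bs"
      by auto
    obtain e where e: "0 < e" "a ^ e \<in> K" using insert.prems by blast
    obtain cs where "is_subfield (lin_span K cs)" "lin_span K bs \<subseteq> lin_span K cs" "a \<in> lin_span K cs"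
      by (rule adjoin_root_lin_span[OF K bs(1,2) e])
    then show ?case using bs(2,3) by (intro exI[of _ cs]) auto
  qed
  then obtain bs where bs: "is_subfield (lin_span K bs)" "K \<subseteq> lin_span K bs" "A \<subseteq> lin_span K bs"
    by blast
  define L where "L = adjoin K P"
  have sub: "is_subfield L"
    unfolding L_def adjoin_def is_subfield_def[of "\<Inter>_"] by (auto intro: is_subfieldD)
  have KL: "K \<subseteq> L" by (auto simp: L_def adjoin_def)
  have "L \<subseteq> lin_span K bs"
    unfolding L_def adjoin_def using bs P[OF bs] by (intro Inter_lower) simp
  from lin_closed_subset_lin_span[OF K lin_closed_subfield[OF sub KL] this]
  obtain ws where ws: "L = lin_span K ws" by blast
  have sub': "set ws \<subseteq> L" using set_subset_lin_span[OF K] ws by blast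
  have "\<forall>y\<in>L. \<exists>c. (\<forall>b\<in>set ws. c b \<in> K) \<and> y = (\<Sum>b\<in>set ws. c b * b)"
    using lin_span_eq_sum[OF K] ws by simp
  then show ?thesis
    unfolding finite_extension_def L_def[symmetric]
    by (intro conjI exI[of _ "set ws"] K sub KL sub' finite_set)
qed


subsection \<open>Ultrametric power series\<close>

context padic_complex_field
begin

section \<open>The absolute value and the field of p-adic numbers\<close>

lemma absp_0 [simp]: "absp 0 = 0"
  by (simp add: absp_eq_0_iff)

lemma absp_1 [simp]: "absp 1 = 1"
  using absp_mult[of 1 1] absp_eq_0_iff[of 1] by simp

lemma absp_minus [simp]: "absp (- x) = absp x"
  by (metis diff_0 diff_0_right dist_absp dist_commute)

lemma absp_power: "absp (x ^ n) = absp x ^ n"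
  by (induction n) (simp_all add: absp_mult)

lemma absp_inverse: "absp (inverse x) = inverse (absp x)"
  by (cases "x = 0") (use absp_mult[of "inverse x" x] in \<open>auto simp: absp_eq_0_iff field_simps\<close>)

lemma absp_prod: "absp (\<Prod>i\<in>A. f i) = (\<Prod>i\<in>A. absp (f i))"
  by (induction A rule: infinite_finite_induct) (simp_all add: absp_mult)

lemma absp_pos: "x \<noteq> 0 \<Longrightarrow> 0 < absp x"
  using absp_nonneg[of x] absp_eq_0_iff[of x] by linarith

lemma absp_sum_le:
  assumes "0 \<le> B" "\<And>x. x \<in> A \<Longrightarrow> absp (f x) \<le> B"
  shows "absp (sum f A) \<le> B"
  using assms(2)
proof (induction A rule: infinite_finite_induct)
  case (insert x A)
  then show ?case using absp_add[of "f x" "sum f A"] by fastforce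
qed (use assms(1) in auto)

text \<open>The strictly larger term determines the absolute value: in x = (x + y) - y the term
  \<open>y\<close> is too small to account for \<open>absp x\<close>.\<close>

lemma absp_add_eq:
  assumes "absp y < absp x" shows "absp (x + y) = absp x"
  using assms absp_add[of x y] absp_add[of "x + y" "- y"] by auto

lemma tendsto_absp_iff: "X \<longlonglongrightarrow> L \<longleftrightarrow> (\<lambda>n. absp (X n - L)) \<longlonglongrightarrow> 0"
  by (subst tendsto_dist_iff) (simp add: dist_absp)

text \<open>Metric and multiplication are linked only through \<open>absp\<close>, so continuity of
  the product is derived from multiplicativity of \<open>absp\<close>.\<close>

lemma LIMSEQ_mult_absp:
  fixes X Y :: "nat \<Rightarrow> 'a"
  assumes X: "X \<longlonglongrightarrow> A" and Y: "Y \<longlonglongrightarrow> B"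
  shows "(\<lambda>n. X n * Y n) \<longlonglongrightarrow> A * B"
proof -
  let ?x = "\<lambda>n. absp (X n - A)" and ?y = "\<lambda>n. absp (Y n - B)"
  have x: "?x \<longlonglongrightarrow> 0" and y: "?y \<longlonglongrightarrow> 0"
    using X Y by (simp_all add: tendsto_absp_iff)
  have "(\<lambda>n. ?x n * ?y n + ?x n * absp B + absp A * ?y n) \<longlonglongrightarrow> 0 * 0 + 0 * absp B + absp A * 0"
    by (intro tendsto_intros x y)
  then have lim: "(\<lambda>n. ?x n * ?y n + ?x n * absp B + absp A * ?y n) \<longlonglongrightarrow> 0" by simp
  have "absp (X n * Y n - A * B) \<le> ?x n * ?y n + ?x n * absp B + absp A * ?y n" for n
  proof -
    have "X n * Y n - A * B = ((X n - A) * (Y n - B) + (X n - A) * B) + A * (Y n - B)"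
      by (simp add: algebra_simps)
    also have "absp \<dots> \<le> absp ((X n - A) * (Y n - B)) + absp ((X n - A) * B) + absp (A * (Y n - B))"
      using absp_add[of "(X n - A) * (Y n - B) + (X n - A) * B" "A * (Y n - B)"]
        absp_add[of "(X n - A) * (Y n - B)" "(X n - A) * B"]
        absp_nonneg[of "(X n - A) * (Y n - B)"] absp_nonneg[of "(X n - A) * B"] absp_nonneg[of "A * (Y n - B)"]
      by linarith
    finally show ?thesis by (simp add: absp_mult)
  qed
  then show ?thesis
    unfolding tendsto_absp_iff by (intro tendsto_sandwich[OF _ _ tendsto_const lim]) (auto simp: absp_nonneg)
qed

lemma is_subfield_Qp: "is_subfield (Qp :: 'a set)"
proof -
  have Qp_iff: "x \<in> Qp \<longleftrightarrow> (\<forall>e>0. \<exists>r\<in>\<rat>. absp (r - x) < e)" for x :: 'a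
    by (simp add: Qp_def closure_approachable dist_absp)
  have Qp_seq: "x \<in> Qp \<longleftrightarrow> (\<exists>X. (\<forall>n. X n \<in> \<rat>) \<and> X \<longlonglongrightarrow> x)" for x :: 'a
    by (simp add: Qp_def closure_sequential)
  have rat: "x \<in> Qp" if "x \<in> \<rat>" for x :: 'a
    unfolding Qp_def using that closure_subset by (rule subsetD[rotated])
  have add: "x + y \<in> Qp" if x: "x \<in> Qp" and y: "y \<in> Qp" for x y :: 'a
    unfolding Qp_iff
  proof (intro allI impI)
    fix e :: real assume "0 < e"
    obtain r where r: "r \<in> \<rat>" "absp (r - x) < e" using x \<open>0 < e\<close> unfolding Qp_iff by auto
    obtain s where s: "s \<in> \<rat>" "absp (s - y) < e" using y \<open>0 < e\<close> unfolding Qp_iff by auto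
    have eq: "(r + s) - (x + y) = (r - x) + (s - y)" by simp
    have "absp ((r + s) - (x + y)) < e"
      unfolding eq by (rule le_less_trans[OF absp_add]) (use r(2) s(2) in simp)
    then show "\<exists>r\<in>\<rat>. absp (r - (x + y)) < e" using r(1) s(1) by (intro bexI[of _ "r + s"]) auto
  qed
  have mult: "x * y \<in> Qp" if "x \<in> Qp" "y \<in> Qp" for x y :: 'a
  proof -
    obtain X where X: "\<And>n. X n \<in> \<rat>" "X \<longlonglongrightarrow> x" using \<open>x \<in> Qp\<close> unfolding Qp_seq by auto
    obtain Y where Y: "\<And>n. Y n \<in> \<rat>" "Y \<longlonglongrightarrow> y" using \<open>y \<in> Qp\<close> unfolding Qp_seq by auto
    show ?thesis
      unfolding Qp_seq using X(1) Y(1) LIMSEQ_mult_absp[OF X(2) Y(2)]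
      by (intro exI[of _ "\<lambda>n. X n * Y n"]) auto
  qed
  have inv: "inverse x \<in> Qp" if x: "x \<in> Qp" for x :: 'a
  proof (cases "x = 0")
    case False
    note pos = absp_pos[OF this]
    show ?thesis
      unfolding Qp_iff
    proof (intro allI impI)
      fix e :: real assume e: "0 < e"
      \<comment> \<open>The first bound forces \<open>absp r = absp x\<close>, so that the error of
        the inverse is \<open>absp (r - x)\<close> divided by the square of \<open>absp x\<close>.
        The second bound makes this less than \<open>e\<close>.\<close>
      define d where "d = min (absp x) (e * (absp x * absp x))"
      have "d > 0" using e pos by (simp add: d_def)
      then obtain r where r: "r \<in> \<rat>" "absp (r - x) < d" using x unfolding Qp_iff by auto
      then have eq: "absp r = absp x" using absp_add_eq[of "r - x" x] by (simp add: d_def)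
      then have "r \<noteq> 0" using pos by auto
      have "inverse r - inverse x = - (inverse r * inverse x * (r - x))"
        using \<open>r \<noteq> 0\<close> False by (simp add: field_simps)
      then have "absp (inverse r - inverse x) = absp (r - x) / (absp x * absp x)"
        by (simp only: absp_minus absp_mult absp_inverse eq) (simp add: divide_inverse)
      also have "\<dots> < e" using r(2) pos by (simp add: d_def pos_divide_less_eq)
      finally show "\<exists>r\<in>\<rat>. absp (r - inverse x) < e" using r(1) by (intro bexI[of _ "inverse r"]) auto
    qed
  qed (simp add: rat)
  have "- x \<in> Qp" if "x \<in> Qp" for x :: 'a
    using mult[of "- 1" x] that rat[of "- 1"] by simp
  then show ?thesis unfolding is_subfield_def using rat add mult inv by auto
qed


section \<open>Coefficient bounds and entire series\<close>

definition coeffs_bounded :: "real \<Rightarrow> 'a fps \<Rightarrow> bool" where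
  "coeffs_bounded r G \<longleftrightarrow> (\<exists>K. \<forall>k. absp (fps_nth G k) \<le> K * r ^ k)"

lemma coeffs_boundedE:
  assumes "coeffs_bounded r G"
  obtains K where "0 \<le> K" "\<And>k. absp (fps_nth G k) \<le> K * r ^ k"
proof -
  obtain K where K: "\<And>k. absp (fps_nth G k) \<le> K * r ^ k"
    using assms by (auto simp: coeffs_bounded_def)
  moreover have "0 \<le> K" using K[of 0] absp_nonneg[of "fps_nth G 0"] by simp
  ultimately show thesis using that by blast
qed

text \<open>The base \<open>r\<close> plays the role of a reciprocal radius, so a smaller
  \<open>r\<close> is the stronger condition.\<close>

lemma coeffs_bounded_mono:
  assumes "coeffs_bounded r G" "0 \<le> r" "r \<le> s" shows "coeffs_bounded s G"
proof -
  obtain K where K: "0 \<le> K" "\<And>k. absp (fps_nth G k) \<le> K * r ^ k"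
    using coeffs_boundedE[OF assms(1)] by blast
  have "absp (fps_nth G k) \<le> K * s ^ k" for k
    using K(2)[of k] mult_left_mono[OF power_mono[OF assms(3,2)] K(1), of k] by linarith
  then show ?thesis by (auto simp: coeffs_bounded_def)
qed

lemma coeffs_bounded_add:
  assumes "coeffs_bounded r G" "coeffs_bounded r H" "0 \<le> r" shows "coeffs_bounded r (G + H)"
proof -
  obtain K where K: "0 \<le> K" "\<And>k. absp (fps_nth G k) \<le> K * r ^ k"
    using coeffs_boundedE[OF assms(1)] by blast
  obtain L where L: "0 \<le> L" "\<And>k. absp (fps_nth H k) \<le> L * r ^ k"
    using coeffs_boundedE[OF assms(2)] by blast
  have "absp (fps_nth (G + H) k) \<le> (K + L) * r ^ k" for k
    using absp_add[of "fps_nth G k" "fps_nth H k"] K(2)[of k] L(2)[of k] absp_nonneg[of "fps_nth G k"]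
      absp_nonneg[of "fps_nth H k"] by (simp add: distrib_right)
  then show ?thesis by (auto simp: coeffs_bounded_def)
qed

text \<open>A coefficient of the product is no larger than its largest summand, so the constants
  multiply and \<open>r\<close> does not change.\<close>

lemma coeffs_bounded_mult:
  assumes "coeffs_bounded r G" "coeffs_bounded r H" "0 \<le> r" shows "coeffs_bounded r (G * H)"
proof -
  obtain K where K: "0 \<le> K" "\<And>k. absp (fps_nth G k) \<le> K * r ^ k"
    using coeffs_boundedE[OF assms(1)] by blast
  obtain L where L: "0 \<le> L" "\<And>k. absp (fps_nth H k) \<le> L * r ^ k"
    using coeffs_boundedE[OF assms(2)] by blast
  have "absp (fps_nth (G * H) k) \<le> (K * L) * r ^ k" for k
    unfolding fps_mult_nth
  proof (rule absp_sum_le)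
    fix i assume i: "i \<in> {0..k}"
    have "absp (fps_nth G i * fps_nth H (k - i)) \<le> (K * r ^ i) * (L * r ^ (k - i))"
      unfolding absp_mult using assms(3) by (intro mult_mono K L absp_nonneg) (simp add: K(1))
    also have "\<dots> = (K * L) * r ^ k" using i by (simp add: power_add[symmetric])
    finally show "absp (fps_nth G i * fps_nth H (k - i)) \<le> (K * L) * r ^ k" .
  qed (simp add: K L assms(3))
  then show ?thesis by (auto simp: coeffs_bounded_def)
qed

lemma coeffs_bounded_monomial: "0 < r \<Longrightarrow> coeffs_bounded r (fps_const c * fps_X ^ D)"
  unfolding coeffs_bounded_def
  by (rule exI[of _ "absp c / r ^ D"]) (auto simp: absp_nonneg)

lemma coeffs_bounded_binomial: "0 < r \<Longrightarrow> coeffs_bounded r (1 - fps_const c * fps_X ^ D)"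
  using coeffs_bounded_add[OF coeffs_bounded_monomial[of r 1 0] coeffs_bounded_monomial[of r "- c" D]]
  by (simp flip: fps_const_neg)

lemma coeffs_bounded_1: "0 < r \<Longrightarrow> coeffs_bounded r 1"
  using coeffs_bounded_monomial[of r 1 0] by simp

lemma entire_imp_coeffs_bounded:
  fixes G :: "'a fps"
  assumes "entire G" "0 < r" shows "coeffs_bounded r G"
proof -
  have p: "1 < real p" using prime_p prime_gt_1_nat by fastforce
  obtain j where j: "(1 / real p) ^ j < r"
    using real_arch_pow_inv[OF assms(2), of "1 / real p"] p by auto
  \<comment> \<open>A point with \<open>absp t\<close> greater than \<open>1 / r\<close>. The terms
    of the convergent series at \<open>t\<close> are bounded, which is the required bound on the
    coefficients.\<close>
  define t :: 'a where "t = inverse (of_nat p ^ j)"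
  have t: "absp t = real p ^ j"
    by (simp add: t_def absp_inverse absp_power absp_p power_one_over)
  let ?S = "\<lambda>n. \<Sum>k<n. fps_nth G k * t ^ k"
  have "Cauchy ?S"
    using assms(1) summable_LIMSEQ LIMSEQ_imp_Cauchy unfolding entire_def by blast
  then obtain M where M: "\<And>m n. M \<le> m \<Longrightarrow> M \<le> n \<Longrightarrow> dist (?S m) (?S n) < 1"
    using metric_CauchyD[of ?S 1] by auto
  \<comment> \<open>From index \<open>M\<close> on the terms are below 1 by the Cauchy property; the
    sum covers the finitely many earlier ones.\<close>
  define K where "K = 1 + (\<Sum>k<M. absp (fps_nth G k * t ^ k))"
  have K: "absp (fps_nth G k * t ^ k) \<le> K" for k
  proof (cases "k < M")
    case True
    then have "absp (fps_nth G k * t ^ k) \<le> (\<Sum>k<M. absp (fps_nth G k * t ^ k))"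
      by (intro member_le_sum) (auto simp: absp_nonneg)
    then show ?thesis by (simp add: K_def)
  next
    case False
    then have "absp (fps_nth G k * t ^ k) < 1"
      using M[of "Suc k" k] by (simp add: dist_absp)
    moreover have "0 \<le> (\<Sum>k<M. absp (fps_nth G k * t ^ k))" by (intro sum_nonneg absp_nonneg)
    ultimately show ?thesis by (simp add: K_def)
  qed
  have "absp (fps_nth G k) \<le> K * ((1 / real p) ^ j) ^ k" for k
    using K[of k] p by (simp add: absp_mult absp_power t power_one_over field_simps)
  then have "coeffs_bounded ((1 / real p) ^ j) G" by (auto simp: coeffs_bounded_def)
  then show ?thesis by (rule coeffs_bounded_mono) (use j p in auto)
qed

text \<open>Converse of \<open>entire_imp_coeffs_bounded\<close>. Only small \<open>r\<close>
  matter, and the later estimates are available for r \<le> 1.\<close>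

lemma entireI:
  fixes G :: "'a fps"
  assumes "\<And>r. 0 < r \<Longrightarrow> r \<le> 1 \<Longrightarrow> coeffs_bounded r G"
  shows "entire G"
  unfolding entire_def
proof
  fix t :: 'a
  \<comment> \<open>With \<open>r * absp t\<close> at most 1/2 the terms decay geometrically. The
    ultrametric inequality then bounds any tail by the bound for its first term.\<close>
  define r where "r = 1 / (2 * (absp t + 1))"
  have r: "0 < r" "r \<le> 1" "r * absp t \<le> 1 / 2"
    using absp_nonneg[of t] by (auto simp: r_def field_simps)
  obtain K where K: "0 \<le> K" "\<And>k. absp (fps_nth G k) \<le> K * r ^ k"
    using coeffs_boundedE[OF assms[OF r(1,2)]] by blast
  have term_le: "absp (fps_nth G k * t ^ k) \<le> K * (1 / 2) ^ k" for k
  proof -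
    have "absp (fps_nth G k * t ^ k) \<le> (K * r ^ k) * absp t ^ k"
      unfolding absp_mult absp_power by (intro mult_right_mono K) (simp add: absp_nonneg)
    also have "\<dots> = K * (r * absp t) ^ k" by (simp add: power_mult_distrib)
    also have "\<dots> \<le> K * (1 / 2) ^ k"
      using r(1,3) by (intro mult_left_mono power_mono K) (auto simp: absp_nonneg)
    finally show ?thesis .
  qed
  let ?S = "\<lambda>n. \<Sum>k<n. fps_nth G k * t ^ k"
  have diff: "dist (?S m) (?S n) \<le> K * (1 / 2) ^ m" if "m \<le> n" for m n
  proof -
    have "?S n - ?S m = (\<Sum>k\<in>{..<n} - {..<m}. fps_nth G k * t ^ k)"
      using that by (subst sum_diff) auto
    moreover have "absp (\<Sum>k\<in>{..<n} - {..<m}. fps_nth G k * t ^ k) \<le> K * (1 / 2) ^ m"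
    proof (rule absp_sum_le)
      fix k assume "k \<in> {..<n} - {..<m}"
      then have "K * (1 / 2) ^ k \<le> K * (1 / 2) ^ m"
        by (intro mult_left_mono power_decreasing K) auto
      then show "absp (fps_nth G k * t ^ k) \<le> K * (1 / 2) ^ m" using term_le[of k] by linarith
    qed (simp add: K)
    ultimately show ?thesis by (metis dist_absp dist_commute)
  qed
  have lim: "(\<lambda>m. K * (1 / 2) ^ m) \<longlonglongrightarrow> 0"
    by (intro tendsto_mult_right_zero LIMSEQ_power_zero) simp
  have "Cauchy ?S"
  proof (rule metric_CauchyI)
    fix e :: real assume "0 < e"
    then obtain M where M: "\<And>m. M \<le> m \<Longrightarrow> K * (1 / 2) ^ m < e"
      using order_tendstoD(2)[OF lim] by (auto simp: eventually_sequentially)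
    have "dist (?S m) (?S n) < e" if "M \<le> m" "M \<le> n" for m n
    proof (cases "m \<le> n")
      case True
      then show ?thesis using diff[of m n] M[OF that(1)] by linarith
    next
      case False
      then show ?thesis using diff[of n m] M[OF that(2)] by (simp add: dist_commute)
    qed
    then show "\<exists>M. \<forall>m\<ge>M. \<forall>n\<ge>M. dist (?S m) (?S n) < e" by blast
  qed
  then show "summable (\<lambda>k. fps_nth G k * t ^ k)"
    by (simp add: summable_iff_convergent Cauchy_convergent)
qed

lemma entire_mult:
  fixes G H :: "'a fps"
  shows "entire G \<Longrightarrow> entire H \<Longrightarrow> entire (G * H)"
  by (intro entireI coeffs_bounded_mult) (auto intro: entire_imp_coeffs_bounded)

lemma entire_1: "entire (1 :: 'a fps)"
  by (intro entireI coeffs_bounded_1)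

lemma entire_prod:
  fixes G :: "'i \<Rightarrow> 'a fps"
  shows "(\<And>i. i \<in> A \<Longrightarrow> entire (G i)) \<Longrightarrow> entire (\<Prod>i\<in>A. G i)"
  by (induction A rule: infinite_finite_induct) (auto intro: entire_mult entire_1)

text \<open>The product of the partial sums differs from the partial sum of the Cauchy product only
  by terms with i + j \<ge> n. Each of these is at most a constant times (1/2)^n, hence so is their
  sum.\<close>

lemma fps_value_mult:
  fixes G H :: "'a fps"
  assumes G: "entire G" and H: "entire H"
  shows "fps_value (G * H) a = fps_value G a * fps_value H a"
proof -
  let ?S = "\<lambda>F n. \<Sum>k<n. fps_nth F k * a ^ k"
  have S: "?S F \<longlonglongrightarrow> fps_value F a" if "entire F" for F
    using that summable_LIMSEQ unfolding entire_def fps_value_def by blast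
  define r where "r = 1 / (2 * (absp a + 1))"
  have r: "0 < r" "r * absp a \<le> 1 / 2"
    using absp_nonneg[of a] by (auto simp: r_def field_simps)
  obtain K where K: "0 \<le> K" "\<And>k. absp (fps_nth G k) \<le> K * r ^ k"
    using coeffs_boundedE[OF entire_imp_coeffs_bounded[OF G r(1)]] by blast
  obtain L where L: "0 \<le> L" "\<And>k. absp (fps_nth H k) \<le> L * r ^ k"
    using coeffs_boundedE[OF entire_imp_coeffs_bounded[OF H r(1)]] by blast
  define t where "t = (\<lambda>i j. (fps_nth G i * a ^ i) * (fps_nth H j * a ^ j))"
  have t: "absp (t i j) \<le> K * L * (1 / 2) ^ (i + j)" for i j
  proof -
    have "absp (t i j) = absp (fps_nth G i) * absp (fps_nth H j) * absp a ^ (i + j)"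
      by (simp add: t_def absp_mult absp_power power_add mult_ac)
    also have "\<dots> \<le> (K * r ^ i) * (L * r ^ j) * absp a ^ (i + j)"
      using r(1) K(1) by (intro mult_right_mono mult_mono K L) (auto simp: absp_nonneg)
    also have "\<dots> = K * L * (r * absp a) ^ (i + j)" by (simp add: power_mult_distrib power_add mult_ac)
    also have "\<dots> \<le> K * L * (1 / 2) ^ (i + j)"
      using r K(1) L(1) by (intro mult_left_mono power_mono) (auto simp: absp_nonneg)
    finally show ?thesis .
  qed
  have diff: "absp (?S G n * ?S H n - ?S (G * H) n) \<le> K * L * (1 / 2) ^ n" for n
  proof -
    let ?T = "{(i, j). i + j < n}"
    have T: "?T \<subseteq> {..<n} \<times> {..<n}" by auto
    have "?S (G * H) n = (\<Sum>k<n. \<Sum>i\<le>k. t i (k - i))"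
    proof (intro sum.cong refl)
      fix k
      have "fps_nth (G * H) k * a ^ k = (\<Sum>i\<le>k. fps_nth G i * fps_nth H (k - i) * a ^ k)"
        by (simp add: fps_mult_nth sum_distrib_right atLeast0AtMost)
      also have "\<dots> = (\<Sum>i\<le>k. t i (k - i))"
      proof (intro sum.cong refl)
        fix i assume "i \<in> {..k}"
        then have "a ^ k = a ^ i * a ^ (k - i)" by (simp flip: power_add)
        then show "fps_nth G i * fps_nth H (k - i) * a ^ k = t i (k - i)" by (simp add: t_def)
      qed
      finally show "fps_nth (G * H) k * a ^ k = (\<Sum>i\<le>k. t i (k - i))" .
    qed
    also have "\<dots> = (\<Sum>(i, j)\<in>?T. t i j)" by (simp add: sum.triangle_reindex)
    finally have "?S G n * ?S H n - ?S (G * H) n = (\<Sum>(i, j)\<in>{..<n} \<times> {..<n}. t i j) - (\<Sum>(i, j)\<in>?T. t i j)"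
      by (simp add: sum_product sum.cartesian_product t_def)
    also have "\<dots> = (\<Sum>(i, j)\<in>{..<n} \<times> {..<n} - ?T. t i j)"
      using T by (subst sum_diff) auto
    also have "absp \<dots> \<le> K * L * (1 / 2) ^ n"
    proof (rule absp_sum_le)
      fix x assume "x \<in> {..<n} \<times> {..<n} - ?T"
      then obtain i j where x: "x = (i, j)" "n \<le> i + j" by auto
      have "K * L * (1 / 2) ^ (i + j) \<le> K * L * (1 / 2) ^ n"
        using x(2) K(1) L(1) by (intro mult_left_mono power_decreasing) auto
      then show "absp (case x of (i, j) \<Rightarrow> t i j) \<le> K * L * (1 / 2) ^ n"
        using t[of i j] by (simp add: x(1))
    qed (simp add: K L)
    finally show ?thesis .
  qed
  have lim: "(\<lambda>n. K * L * (1 / 2) ^ n) \<longlonglongrightarrow> 0"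
    by (intro tendsto_mult_right_zero LIMSEQ_power_zero) simp
  have "(\<lambda>n. absp (?S G n * ?S H n - ?S (G * H) n)) \<longlonglongrightarrow> 0"
    by (rule tendsto_sandwich[OF _ _ tendsto_const lim])
      (intro always_eventually allI absp_nonneg diff)+
  then have "(\<lambda>n. dist (?S (G * H) n) (?S G n * ?S H n)) \<longlonglongrightarrow> 0"
    by (simp only: dist_absp[symmetric] dist_commute)
  moreover have "(\<lambda>n. dist (?S G n * ?S H n) (fps_value G a * fps_value H a)) \<longlonglongrightarrow> 0"
    unfolding tendsto_dist_iff[symmetric] by (intro LIMSEQ_mult_absp S G H)
  ultimately have "(\<lambda>n. dist (?S (G * H) n) (?S G n * ?S H n)
      + dist (?S G n * ?S H n) (fps_value G a * fps_value H a)) \<longlonglongrightarrow> 0"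
    by (rule tendsto_add_zero)
  then have "(\<lambda>n. dist (?S (G * H) n) (fps_value G a * fps_value H a)) \<longlonglongrightarrow> 0"
    by (rule tendsto_sandwich[OF _ _ tendsto_const, rotated 2])
      (intro always_eventually allI dist_triangle zero_le_dist)+
  then have "?S (G * H) \<longlonglongrightarrow> fps_value G a * fps_value H a"
    unfolding tendsto_dist_iff[symmetric] .
  then show ?thesis using S[OF entire_mult[OF G H]] LIMSEQ_unique by blast
qed

lemma fps_value_1: "fps_value 1 (a :: 'a) = 1"
  unfolding fps_value_def by (subst suminf_finite[of "{0}"]) auto

lemma fps_value_prod:
  fixes G :: "'i \<Rightarrow> 'a fps"
  shows "(\<And>i. i \<in> A \<Longrightarrow> entire (G i)) \<Longrightarrow> fps_value (\<Prod>i\<in>A. G i) a = (\<Prod>i\<in>A. fps_value (G i) a)"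
  by (induction A rule: infinite_finite_induct) (auto simp: fps_value_1 fps_value_mult entire_prod)

lemma fps_value_binomial:
  fixes a c :: 'a
  assumes "0 < D" shows "fps_value (1 - fps_const c * fps_X ^ D) a = 1 - c * a ^ D"
proof -
  have "fps_value (1 - fps_const c * fps_X ^ D) a
      = (\<Sum>k\<in>{0, D}. fps_nth (1 - fps_const c * fps_X ^ D) k * a ^ k)"
    unfolding fps_value_def by (rule suminf_finite) auto
  then show ?thesis using assms by simp
qed

text \<open>The constant term 1 strictly dominates all other terms, so every nonempty partial sum
  has absolute value 1 and the limit cannot vanish.\<close>

lemma fps_value_neq_0:
  assumes "entire G" "fps_nth G 0 = 1" "c < 1" "\<And>k. 0 < k \<Longrightarrow> absp (fps_nth G k * a ^ k) \<le> c"
  shows "fps_value G a \<noteq> 0"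
proof
  assume 0: "fps_value G a = 0"
  let ?S = "\<lambda>n. \<Sum>k<n. fps_nth G k * a ^ k"
  have "?S \<longlonglongrightarrow> 0"
    using assms(1) summable_LIMSEQ 0 unfolding entire_def fps_value_def by metis
  then have lim: "(\<lambda>n. absp (?S n)) \<longlonglongrightarrow> 0" by (simp add: tendsto_absp_iff)
  have c: "0 \<le> c" using assms(4)[of 1] absp_nonneg[of "fps_nth G 1 * a ^ 1"] by linarith
  have "absp (?S (Suc n)) = 1" for n
  proof -
    have "?S (Suc n) = 1 + (\<Sum>k<n. fps_nth G (Suc k) * a ^ Suc k)"
      by (subst sum.lessThan_Suc_shift) (simp add: assms(2))
    moreover have "absp (\<Sum>k<n. fps_nth G (Suc k) * a ^ Suc k) < absp 1"
      using absp_sum_le[OF c, of "{..<n}" "\<lambda>k. fps_nth G (Suc k) * a ^ Suc k"] assms(3,4)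
      by fastforce
    ultimately show ?thesis using absp_add_eq by simp
  qed
  with LIMSEQ_Suc[OF lim] have "(\<lambda>n::nat. 1 :: real) \<longlonglongrightarrow> 0" by simp
  then show False using LIMSEQ_unique[OF tendsto_const[of "1::real"]] by fastforce
qed

text \<open>A pole is given by some representation as a quotient; cross-multiplying with a second
  representation shows that every other denominator vanishes there too.\<close>

lemma fps_value_pole:
  fixes a :: 'a
  assumes FGH: "entire_quotient F G H" and a: "a \<in> poles F"
  shows "fps_value H a = 0"
proof -
  obtain G' H' where FGH': "entire_quotient F G' H'" and z: "fps_value H' a = 0" "fps_value G' a \<noteq> 0"
    using a by (auto simp: poles_def)
  have e: "entire G" "entire H" "entire G'" "entire H'" and F: "F * H = G" "F * H' = G'"
    using FGH FGH' by (auto simp: entire_quotient_def)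
  have "G' * H = G * H'" by (simp add: F[symmetric] mult_ac)
  then have "fps_value G' a * fps_value H a = fps_value G a * fps_value H' a"
    using fps_value_mult e by metis
  then show ?thesis using z by simp
qed

end


subsection \<open>Increasing functions that are polynomial on axis-parallel lines\<close>

text \<open>An arbitrary index set takes the place of an initial segment because the induction
  removes variables in any order.\<close>

definition supported :: "nat set \<Rightarrow> (nat \<Rightarrow> nat) set" where
  "supported S = {x. \<forall>i. i \<notin> S \<longrightarrow> x i = 0}"

text \<open>Polynomiality is required only line by line. This suffices for the growth argument and
  is visibly stable under translation.\<close>

definition monotone_sep_poly :: "((nat \<Rightarrow> nat) \<Rightarrow> nat) \<Rightarrow> bool" where
  "monotone_sep_poly g \<longleftrightarrow> (\<forall>i y. g y \<le> g (y(i := Suc (y i)))) \<and>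
     (\<forall>i y. \<exists>u. \<forall>t. real (g (y(i := t))) = poly u (real t))"

lemma supported_upd: "x \<in> supported S \<Longrightarrow> i \<in> S \<Longrightarrow> x(i := t) \<in> supported S"
  by (auto simp: supported_def)

text \<open>If \<open>w\<close> does not eventually dominate \<open>C * t\<close>, then
  \<open>u\<close> minus the linear polynomial \<open>C * t\<close> has negative leading
  coefficient. In degree at least 2 this would be the leading coefficient of \<open>u\<close>,
  making \<open>w\<close> negative for large \<open>t\<close>. So \<open>u\<close> is affine, and
  the same comparisons confine its slope to the range from 0 to \<open>C\<close>.\<close>

lemma poly_nat_linear:
  fixes w :: "nat \<Rightarrow> nat"
  assumes u: "\<And>t. real (w t) = poly u (real t)"
    and slow: "\<not> (\<exists>t0. \<forall>t\<ge>t0. C * t \<le> w t)"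
  shows "\<exists>a\<le>C. \<forall>t. w t = w 0 + a * t"
proof -
  have pos_lc: "\<exists>t0. \<forall>t\<ge>t0. 0 < poly v (real t)" if lc: "0 < lead_coeff v" for v
  proof -
    obtain b where b: "\<And>x. b \<le> x \<Longrightarrow> lead_coeff v \<le> poly v x"
      using poly_pinfty_gt_lc[OF lc] by blast
    have "0 < poly v (real t)" if "nat \<lceil>b\<rceil> \<le> t" for t
    proof -
      have "b \<le> real t" using that by linarith
      then show ?thesis using b[of "real t"] lc by linarith
    qed
    then show ?thesis by blast
  qed
  define v where "v = u - [:0, real C:]"
  have v: "poly v (real t) = real (w t) - real (C * t)" for t
    by (simp add: v_def u mult.commute)
  have "v \<noteq> 0"
  proof
    assume "v = 0"
    then have "C * t \<le> w t" for t using v[of t] by (simp flip: of_nat_mult)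
    then show False using slow by blast
  qed
  moreover have "\<not> 0 < lead_coeff v"
  proof
    assume "0 < lead_coeff v"
    then obtain t0 where "\<And>t. t0 \<le> t \<Longrightarrow> 0 < poly v (real t)" using pos_lc by blast
    then have "\<forall>t\<ge>t0. C * t \<le> w t" unfolding v by (simp add: less_imp_le flip: of_nat_mult)
    then show False using slow by blast
  qed
  ultimately have lc: "lead_coeff v < 0" by (meson leading_coeff_0_iff linorder_cases)
  have "degree u \<le> 1"
  proof (rule ccontr)
    assume deg: "\<not> degree u \<le> 1"
    then have "degree v = degree u"
      unfolding v_def diff_conv_add_uminus by (intro degree_add_eq_left) (auto split: if_splits)
    then have "lead_coeff v = lead_coeff u"
      using deg by (auto simp: v_def coeff_pCons split: nat.split)
    then obtain t0 where "\<And>t. t0 \<le> t \<Longrightarrow> 0 < poly (- u) (real t)"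
      using pos_lc[of "- u"] lc by auto
    from this[of t0] show False using u[of t0] by simp
  qed
  then have "u = [:coeff u 0, coeff u 1:]"
    by (intro poly_eqI) (auto simp: coeff_pCons coeff_eq_0 split: nat.split)
  then obtain b c where "u = [:b, c:]" by blast
  then have w: "real (w t) = b + c * real t" for t using u[of t] by (simp add: mult.commute)
  have b: "b = real (w 0)" using w[of 0] by simp
  obtain t0 where "\<And>t. t0 \<le> t \<Longrightarrow> 0 < poly (- v) (real t)"
    using pos_lc[of "- v"] lc by auto
  \<comment> \<open>The successor makes the argument positive, so that it can be cancelled.\<close>
  then have "0 < poly (- v) (real (Suc t0))" by (simp del: of_nat_Suc)
  then have "real (w 0) + c * real (Suc t0) < real C * real (Suc t0)"
    using v[of "Suc t0"] w[of "Suc t0"] b by (simp add: distrib_left)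
  then have "c * real (Suc t0) < real C * real (Suc t0)"
    using of_nat_0_le_iff[of "w 0", where ?'a = real] by linarith
  then have cC: "c < real C" by (rule mult_right_less_imp_less) simp
  have "0 \<le> c"
  proof (rule ccontr)
    assume "\<not> 0 \<le> c"
    then obtain t where "b < real t * (- c)" using reals_Archimedean3[of "- c"] by auto
    then have "b + c * real t < 0" by (simp add: mult.commute)
    then show False using w[of t] of_nat_0_le_iff[of "w t", where ?'a = real] by linarith
  qed
  moreover have c: "c = real (w 1) - real (w 0)" using w[of 1] b by simp
  ultimately have c': "c = real (w 1 - w 0)" by simp
  have "real (w t) = real (w 0 + (w 1 - w 0) * t)" for t
    using w[of t] b c' by simp
  then have "\<forall>t. w t = w 0 + (w 1 - w 0) * t" unfolding of_nat_eq_iff by blast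
  moreover have "w 1 - w 0 \<le> C" using cC unfolding c' by simp
  ultimately show ?thesis by blast
qed

text \<open>Monotonicity is given for unit steps only; the coordinates in \<open>A\<close> are
  raised one after another.\<close>

lemma monotone_sep_poly_mono:
  assumes g: "monotone_sep_poly g" and "finite A"
    and "\<And>j. x j \<le> z j" "\<And>j. j \<notin> A \<Longrightarrow> x j = z j"
  shows "g x \<le> g z"
  using assms(2-4)
proof (induction A arbitrary: x)
  case empty
  then have "x = z" by auto
  then show ?case by simp
next
  case (insert j A)
  have step: "g x \<le> g (x(j := x j + k))" for k
  proof (induction k)
    case (Suc k)
    have "g (x(j := x j + k)) \<le> g ((x(j := x j + k))(j := Suc ((x(j := x j + k)) j)))"
      using g unfolding monotone_sep_poly_def by blast
    then have "g (x(j := x j + k)) \<le> g (x(j := x j + Suc k))" by simp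
    with Suc show ?case by (rule order_trans)
  qed simp
  have "x j + (z j - x j) = z j" using insert.prems(1)[of j] by simp
  then have "g x \<le> g (x(j := z j))" using step[of "z j - x j"] by simp
  also have "\<dots> \<le> g z" using insert.prems by (intro insert.IH) auto
  finally show ?case .
qed

lemma monotone_sep_poly_shift:
  assumes g: "monotone_sep_poly g"
  shows "monotone_sep_poly (\<lambda>x. g (\<lambda>j. x j + y j))"
  unfolding monotone_sep_poly_def
proof (intro conjI allI)
  fix i and x :: "nat \<Rightarrow> nat"
  have upd: "(\<lambda>j. (x(i := t)) j + y j) = (\<lambda>j. x j + y j)(i := t + y i)" for t by auto
  show "g (\<lambda>j. x j + y j) \<le> g (\<lambda>j. (x(i := Suc (x i))) j + y j)"
    unfolding upd add_Suc using g[unfolded monotone_sep_poly_def, THEN conjunct1, rule_format, of "\<lambda>j. x j + y j" i]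
    by simp
  obtain u where u: "\<And>t. real (g ((\<lambda>j. x j + y j)(i := t))) = poly u (real t)"
    using g unfolding monotone_sep_poly_def by blast
  have "real (g (\<lambda>j. (x(i := t)) j + y j)) = poly (pcompose u [:real (y i), 1:]) (real t)" for t
    unfolding upd u by (simp add: poly_pcompose add.commute)
  then show "\<exists>u. \<forall>t. real (g (\<lambda>j. (x(i := t)) j + y j)) = poly u (real t)" by blast
qed

text \<open>On each line in direction \<open>i\<close>, \<open>g\<close> is affine with slope at most \<open>C\<close>; being bounded and
  polynomial in the base point, the slope is constant.\<close>

lemma monotone_sep_poly_slope:
  assumes g: "monotone_sep_poly g" and "finite S" "i \<in> S"
    and slow: "\<not> (\<exists>y\<in>supported S. \<exists>t0. \<forall>t\<ge>t0. C * t \<le> g (y(i := t)))"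
  shows "\<exists>s. \<forall>y\<in>supported S. g (y(i := Suc (y i))) = g y + s"
proof -
  have poly: "\<exists>u. \<forall>t. real (g (y(i := t))) = poly u (real t)" for i y
    using g unfolding monotone_sep_poly_def by blast
  define a where "a = (\<lambda>y. g (y(i := 1)) - g (y(i := 0)))"
  have a: "a y \<le> C \<and> (\<forall>t. g (y(i := t)) = g (y(i := 0)) + a y * t)" if "y \<in> supported S" for y
  proof -
    obtain u where "\<And>t. real (g (y(i := t))) = poly u (real t)" using poly by blast
    moreover have "\<not> (\<exists>t0. \<forall>t\<ge>t0. C * t \<le> g (y(i := t)))" using slow that by blast
    ultimately obtain b where b: "b \<le> C" "\<And>t. g (y(i := t)) = g (y(i := 0)) + b * t"
      using poly_nat_linear[of "\<lambda>t. g (y(i := t))"] by blast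
    moreover have "a y = b" using b(2)[of 1] by (simp add: a_def)
    ultimately show ?thesis by blast
  qed
  have line: "a (y(j := t)) = a (y(j := 0))" if y: "y \<in> supported S" and j: "j \<in> S" for y j t
  proof (cases "j = i")
    case False
    define w where "w = (\<lambda>t. a (y(j := t)))"
    obtain u1 where u1: "\<And>t. real (g (y(i := 1, j := t))) = poly u1 (real t)" using poly by blast
    obtain u0 where u0: "\<And>t. real (g (y(i := 0, j := t))) = poly u0 (real t)" using poly by blast
    have bd: "w t \<le> C" for t using a supported_upd[OF y j] by (simp add: w_def)
    \<comment> \<open>This makes the truncated subtraction in \<open>a\<close> an honest difference,
      so \<open>w\<close> is polynomial.\<close>
    have "g (y(j := t, i := 0)) \<le> g (y(j := t, i := 1))" for t
      using a[OF supported_upd[OF y j]] by (metis le_add1)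
    then have "real (w t) = poly (u1 - u0) (real t)" for t
      using u1[of t] u0[of t] False by (simp add: w_def a_def of_nat_diff fun_upd_twist)
    \<comment> \<open>Being bounded by \<open>C\<close>, \<open>w\<close> cannot dominate (C + 1) t,
      so \<open>poly_nat_linear\<close> applies a second time, now to the slope.\<close>
    moreover have "\<not> (\<exists>t0. \<forall>t\<ge>t0. Suc C * t \<le> w t)"
    proof
      assume "\<exists>t0. \<forall>t\<ge>t0. Suc C * t \<le> w t"
      then obtain t0 where "Suc C * Suc t0 \<le> w (Suc t0)" by (meson le_SucI order_refl)
      then show False using bd[of "Suc t0"] by simp
    qed
    ultimately obtain b where b: "\<And>t. w t = w 0 + b * t"
      using poly_nat_linear[of w "u1 - u0" "Suc C"] by blast
    \<comment> \<open>A slope \<open>b\<close> of at least 1 would exceed the bound \<open>C\<close>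
      already at \<open>t = C + 1\<close>.\<close>
    have "b * Suc C \<le> C" using b[of "Suc C"] bd[of "Suc C"] by simp
    then have "b = 0" by (cases b) auto
    then show ?thesis using b[of t] by (simp add: w_def)
  qed (simp add: a_def)
  have "a y = a (\<lambda>_. 0)" if "finite A" "A \<subseteq> S" "y \<in> supported A" for A y
    using that
  proof (induction A arbitrary: y)
    case empty
    then have "y = (\<lambda>_. 0)" by (auto simp: supported_def)
    then show ?case by simp
  next
    case (insert j A)
    have "y \<in> supported S" "j \<in> S" using insert.prems by (auto simp: supported_def)
    from line[OF this, of "y j"] have "a y = a (y(j := 0))" by simp
    also have "\<dots> = a (\<lambda>_. 0)" using insert.prems by (intro insert.IH) (auto simp: supported_def)
    finally show ?case .
  qed
  then have const: "a y = a (\<lambda>_. 0)" if "y \<in> supported S" for y using assms(2) that by blast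
  have "g (y(i := Suc (y i))) = g y + a (\<lambda>_. 0)" if y: "y \<in> supported S" for y
  proof -
    have "g y = g (y(i := 0)) + a y * y i" using a[OF y] by (metis fun_upd_triv)
    moreover have "g (y(i := Suc (y i))) = g (y(i := 0)) + a y * Suc (y i)" using a[OF y] by blast
    ultimately show ?thesis by (simp add: const[OF y])
  qed
  then show ?thesis by blast
qed


subsection \<open>Generating series\<close>

locale padic_weighted = padic_complex_field p absp
  for p :: nat and absp :: "'a::{field_char_0,complete_space} \<Rightarrow> real" +
  fixes \<pi> :: 'a and n :: nat and d :: "nat \<Rightarrow> nat"
  assumes pi_pos: "0 < absp \<pi>" and pi_less_1: "absp \<pi> < 1"
    and weight_pos: "i < n \<Longrightarrow> 0 < d i"
begin

section \<open>Euler's product and its zeros\<close>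

definition euler_coeff :: "nat \<Rightarrow> 'a" where
  "euler_coeff k = (\<Prod>j<k. \<pi> ^ j / (\<pi> ^ Suc j - 1))"

text \<open>\<open>euler_fps j D\<close> is \<open>\<Prod>m\<ge>j. 1 - \<pi>\<^sup>m T\<^sup>D\<close>, written as a series by Euler's identity
  \<open>(\<Prod>m. 1 - \<pi>\<^sup>m z) = (\<Sum>k. z\<^sup>k \<Prod>j<k. \<pi>\<^sup>j / (\<pi>\<^sup>j\<^sup>+\<^sup>1 - 1))\<close>.\<close>

definition euler_fps :: "nat \<Rightarrow> nat \<Rightarrow> 'a fps" where
  "euler_fps j D = Abs_fps (\<lambda>k. euler_coeff k * (\<pi> ^ j) ^ k) oo fps_X ^ D"

lemma absp_pi_power_le: "absp \<pi> ^ k \<le> 1"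
  using pi_pos pi_less_1 by (intro power_le_one) auto

lemma absp_pi_power_minus_1: "absp (\<pi> ^ Suc j - 1) = 1"
proof -
  have "absp \<pi> ^ Suc j < 1" using pi_pos pi_less_1 by (simp only: power_Suc_less_one)
  then have "absp (- 1 + \<pi> ^ Suc j) = absp (- 1)" by (intro absp_add_eq) (simp add: absp_power del: power_Suc)
  then show ?thesis by simp
qed

lemma absp_euler_coeff: "absp (euler_coeff k) = (\<Prod>j<k. absp \<pi> ^ j)"
  by (simp add: euler_coeff_def absp_prod divide_inverse absp_mult absp_inverse absp_power
      absp_pi_power_minus_1 del: power_Suc)

lemma absp_euler_coeff_le_1: "absp (euler_coeff k) \<le> 1"
  unfolding absp_euler_coeff by (intro prod_le_1) (use pi_pos absp_pi_power_le in auto)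

text \<open>The absolute value is \<open>absp \<pi>\<close> to the power k (k - 1) / 2, which decays
  faster than any geometric sequence: from some \<open>M\<close> on each new factor is at most
  \<open>r\<close>, and the constant \<open>1 / r ^ M\<close> pays for the earlier ones.\<close>

lemma euler_coeff_decay:
  assumes "0 < r" "r \<le> 1"
  shows "\<exists>K. \<forall>k. absp (euler_coeff k) \<le> K * r ^ k"
proof -
  obtain M where M: "absp \<pi> ^ M < r" using real_arch_pow_inv[OF assms(1) pi_less_1] by blast
  have "absp (euler_coeff k) * r ^ M \<le> r ^ k" for k
  proof (induction k)
    case 0
    show ?case using assms by (simp add: euler_coeff_def power_le_one)
  next
    case (Suc k)
    show ?case
    proof (cases "k < M")
      case True
      have "absp (euler_coeff (Suc k)) * r ^ M \<le> 1 * r ^ M"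
        by (intro mult_right_mono absp_euler_coeff_le_1) (use assms in auto)
      also have "\<dots> \<le> r ^ Suc k" using True assms by (simp add: power_decreasing del: power_Suc)
      finally show ?thesis .
    next
      case False
      then have "absp \<pi> ^ k \<le> absp \<pi> ^ M" using pi_pos pi_less_1 by (intro power_decreasing) auto
      then have "absp \<pi> ^ k \<le> r" using M by linarith
      then have "(absp (euler_coeff k) * r ^ M) * absp \<pi> ^ k \<le> r ^ k * r"
        using assms by (intro mult_mono Suc) (auto simp: absp_nonneg)
      then show ?thesis by (simp add: absp_euler_coeff mult_ac)
    qed
  qed
  then have "absp (euler_coeff k) \<le> (1 / r ^ M) * r ^ k" for k
    using assms by (simp add: field_simps)
  then show ?thesis by blast
qed

lemma euler_fps_nth:
  "fps_nth (euler_fps j D) k = (if D dvd k then euler_coeff (k div D) * (\<pi> ^ j) ^ (k div D) else 0)"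
  by (simp add: euler_fps_def fps_nth_compose_X_power)

lemma euler_fps_nth_0: "fps_nth (euler_fps j D) 0 = 1"
  by (simp add: euler_fps_nth euler_coeff_def)

lemma entire_euler_fps:
  assumes "0 < D" shows "entire (euler_fps j D)"
proof (rule entireI)
  fix r :: real assume r: "0 < r" "r \<le> 1"
  \<comment> \<open>The nonzero coefficients sit at multiples of \<open>D\<close>, so the decay is
    needed with ratio \<open>r ^ D\<close>.\<close>
  then obtain K where K: "\<And>k. absp (euler_coeff k) \<le> K * (r ^ D) ^ k"
    using euler_coeff_decay[of "r ^ D"] by (auto simp: power_le_one)
  have K0: "0 \<le> K" using K[of 0] absp_nonneg[of "euler_coeff 0"] by simp
  have "absp (fps_nth (euler_fps j D) k) \<le> K * r ^ k" for k
  proof (cases "D dvd k")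
    case True
    have "absp (euler_coeff (k div D)) * absp \<pi> ^ (j * (k div D)) \<le> K * (r ^ D) ^ (k div D) * 1"
      using K0 r by (intro mult_mono K absp_pi_power_le) (auto simp: absp_nonneg)
    then show ?thesis
      using True by (simp add: euler_fps_nth absp_mult absp_power flip: power_mult)
  qed (use K0 r in \<open>simp add: euler_fps_nth\<close>)
  then show "coeffs_bounded r (euler_fps j D)" by (auto simp: coeffs_bounded_def)
qed

text \<open>Before T^D is substituted, comparing coefficients of the functional equation E_j(z) = (1
  - \<pi>^j z) E_(j+1)(z) gives exactly the recurrence of \<open>euler_coeff\<close>.\<close>

lemma euler_fps_Suc:
  assumes "0 < D"
  shows "euler_fps j D = (1 - fps_const (\<pi> ^ j) * fps_X ^ D) * euler_fps (Suc j) D"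
proof -
  let ?E = "\<lambda>j. Abs_fps (\<lambda>k. euler_coeff k * (\<pi> ^ j) ^ k)"
  have "?E j = (1 - fps_const (\<pi> ^ j) * fps_X) * ?E (Suc j)"
  proof (rule fps_ext)
    fix k
    show "fps_nth (?E j) k = fps_nth ((1 - fps_const (\<pi> ^ j) * fps_X) * ?E (Suc j)) k"
    proof (cases k)
      case (Suc l)
      have "\<pi> ^ Suc l - 1 \<noteq> 0" using absp_pi_power_minus_1[of l] by auto
      then have c: "euler_coeff (Suc l) * (\<pi> ^ Suc l - 1) = euler_coeff l * \<pi> ^ l"
        by (simp add: euler_coeff_def del: power_Suc)
      have "euler_coeff (Suc l) * (\<pi> ^ j) ^ Suc l * (\<pi> ^ Suc l - 1)
          = \<pi> ^ j * (euler_coeff l * (\<pi> ^ Suc j) ^ l)"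
      proof -
        have "euler_coeff (Suc l) * (\<pi> ^ j) ^ Suc l * (\<pi> ^ Suc l - 1)
            = (euler_coeff l * \<pi> ^ l) * (\<pi> ^ j) ^ Suc l"
          unfolding c[symmetric] by (simp only: mult_ac)
        also have "\<dots> = \<pi> ^ j * (euler_coeff l * (\<pi> ^ Suc j) ^ l)"
          by (simp add: power_mult_distrib mult_ac)
        finally show ?thesis .
      qed
      moreover have "(\<pi> ^ Suc j) ^ Suc l = (\<pi> ^ j) ^ Suc l * \<pi> ^ Suc l"
        by (simp add: power_mult_distrib mult_ac)
      ultimately show ?thesis
        by (simp add: Suc left_diff_distrib mult.assoc right_diff_distrib
            del: power_Suc) (simp add: algebra_simps)
    qed (simp add: left_diff_distrib mult.assoc)
  qed
  then have "?E j oo fps_X ^ D = ((1 - fps_const (\<pi> ^ j) * fps_X) * ?E (Suc j)) oo fps_X ^ D" by simp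
  also have "\<dots> = (1 - fps_const (\<pi> ^ j) * fps_X ^ D) * (?E (Suc j) oo fps_X ^ D)"
    using assms by (simp add: fps_compose_mult_distrib fps_compose_sub_distrib)
  finally show ?thesis by (simp add: euler_fps_def)
qed

lemma euler_fps_split:
  assumes "0 < D"
  shows "euler_fps 0 D = (\<Prod>j<s. 1 - fps_const (\<pi> ^ j) * fps_X ^ D) * euler_fps s D"
proof (induction s)
  case (Suc s)
  then show ?case by (simp add: euler_fps_Suc[OF assms, of s] mult.assoc)
qed simp

lemma entire_binomial: "entire (1 - fps_const c * fps_X ^ D :: 'a fps)"
  by (intro entireI coeffs_bounded_binomial)

text \<open>A zero of the infinite product is a zero of a factor. After splitting off sufficiently
  many factors, the constant term of the remaining product dominates at \<open>a\<close>, so one of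
  the finitely many split factors vanishes.\<close>

lemma euler_fps_zero:
  assumes D: "0 < D" and 0: "fps_value (euler_fps 0 D) a = 0"
  shows "\<exists>j. \<pi> ^ j * a ^ D = 1"
proof -
  \<comment> \<open>Adding 1 in the denominator also covers a = 0.\<close>
  obtain s where s: "absp \<pi> ^ s < 1 / (absp a ^ D + 1)"
    using real_arch_pow_inv[OF _ pi_less_1, of "1 / (absp a ^ D + 1)"] absp_nonneg[of a]
    by (auto simp: add_nonneg_pos)
  define c where "c = absp \<pi> ^ s * absp a ^ D"
  have c: "0 \<le> c" "c < 1"
  proof -
    have "0 \<le> absp a ^ D" by (simp add: absp_nonneg)
    then have "absp \<pi> ^ s * (absp a ^ D + 1) < 1" using s by (simp add: pos_less_divide_eq)
    then show "c < 1" using pi_pos by (simp add: c_def distrib_left) (smt (verit) zero_less_power)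
  qed (simp add: c_def absp_nonneg)
  have "fps_value (euler_fps s D) a \<noteq> 0"
  proof (rule fps_value_neq_0[OF entire_euler_fps[OF D] euler_fps_nth_0 c(2)])
    fix k :: nat assume k: "0 < k"
    show "absp (fps_nth (euler_fps s D) k * a ^ k) \<le> c"
    proof (cases "D dvd k")
      case True
      then obtain l where l: "k = D * l" "0 < l" using k by auto
      have "absp (fps_nth (euler_fps s D) k * a ^ k) = absp (euler_coeff l) * c ^ l"
        using D by (simp add: l euler_fps_nth absp_mult absp_power c_def power_mult_distrib power_mult)
      also have "\<dots> \<le> 1 * c ^ 1"
        using c l(2) by (intro mult_mono absp_euler_coeff_le_1 power_decreasing) (auto simp: absp_nonneg)
      finally show ?thesis by simp
    qed (simp add: euler_fps_nth c)
  qed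
  moreover have "fps_value (euler_fps 0 D) a
      = (\<Prod>j<s. 1 - \<pi> ^ j * a ^ D) * fps_value (euler_fps s D) a"
    by (subst euler_fps_split[OF D, of s])
      (simp add: fps_value_mult fps_value_prod fps_value_binomial entire_prod entire_binomial
        entire_euler_fps D)
  ultimately have "\<exists>j<s. 1 - \<pi> ^ j * a ^ D = 0" using 0 by auto
  then show ?thesis by auto
qed


section \<open>Generating series over the vectors supported in a set of variables\<close>

definition weight :: "(nat \<Rightarrow> nat) \<Rightarrow> nat" where
  "weight x = (\<Sum>i<n. d i * x i)"

definition power_series :: "nat set \<Rightarrow> ((nat \<Rightarrow> nat) \<Rightarrow> nat) \<Rightarrow> 'a fps" where
  "power_series S g = Abs_fps (\<lambda>m. \<Sum>x\<in>{x \<in> supported S. weight x = m}. \<pi> ^ g x)"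

definition denominator :: "nat set \<Rightarrow> 'a fps" where
  "denominator S = (\<Prod>i\<in>S. euler_fps 0 (d i))"

lemma finite_weight_level: "S \<subseteq> {..<n} \<Longrightarrow> finite {x \<in> supported S. weight x = m}"
  by (rule finite_subset[OF _ finite_gen_series_index[of n d m]])
    (auto simp: weight_def nat_vectors_def supported_def weight_pos)

lemma weight_upd: "i < n \<Longrightarrow> weight (x(i := Suc (x i))) = weight x + d i"
  unfolding weight_def by (simp add: sum.remove[of _ i] cong: sum.cong_simp)

lemma entire_denominator: "S \<subseteq> {..<n} \<Longrightarrow> entire (denominator S)"
  unfolding denominator_def by (intro entire_prod entire_euler_fps) (auto simp: weight_pos)

text \<open>Vectors with x_i = 0 give the first summand. The others are unit shifts in direction
  \<open>i\<close> of arbitrary vectors, which raises the weight by \<open>d i\<close>.\<close>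

lemma power_series_split:
  assumes S: "S \<subseteq> {..<n}" and i: "i \<in> S"
  shows "power_series S g = power_series (S - {i}) g
    + fps_X ^ d i * power_series S (\<lambda>x. g (x(i := Suc (x i))))"
proof (rule fps_ext)
  fix m
  let ?L = "\<lambda>m. {x \<in> supported S. weight x = m}"
  have "i < n" using S i by auto
  have split: "?L m = {x \<in> supported (S - {i}). weight x = m} \<union> {x \<in> ?L m. 0 < x i}"
    by (auto simp: supported_def)
  have le: "d i \<le> weight x" if "0 < x i" for x
    using weight_upd[OF \<open>i < n\<close>, of "x(i := x i - 1)"] that by simp
  have shift: "(\<Sum>x\<in>{x \<in> ?L m. 0 < x i}. \<pi> ^ g x)
      = (if m < d i then 0 else \<Sum>x\<in>?L (m - d i). \<pi> ^ g (x(i := Suc (x i))))"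
  proof (cases "m < d i")
    case True
    then have "\<not> (weight x = m \<and> 0 < x i)" for x using le[of x] by (cases "0 < x i") auto
    then have "{x \<in> ?L m. 0 < x i} = {}" by blast
    then show ?thesis using True by (simp only: sum.empty if_True)
  next
    case False
    have "(\<Sum>x\<in>{x \<in> ?L m. 0 < x i}. \<pi> ^ g x) = (\<Sum>x\<in>?L (m - d i). \<pi> ^ g (x(i := Suc (x i))))"
    proof (rule sum.reindex_bij_witness[of _ "\<lambda>x. x(i := Suc (x i))" "\<lambda>x. x(i := x i - 1)"])
      fix x assume x: "x \<in> {x \<in> ?L m. 0 < x i}"
      then show "x(i := x i - 1) \<in> ?L (m - d i)"
        using weight_upd[OF \<open>i < n\<close>, of "x(i := x i - 1)"] i by (auto simp: supported_def)
    next
      fix x assume "x \<in> ?L (m - d i)"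
      then show "x(i := Suc (x i)) \<in> {x \<in> ?L m. 0 < x i}"
        using weight_upd[OF \<open>i < n\<close>, of x] i False by (auto simp: supported_def)
    qed auto
    then show ?thesis using False by simp
  qed
  have fin: "finite {x \<in> supported (S - {i}). weight x = m}" "finite {x \<in> ?L m. 0 < x i}"
    using S by (auto intro: finite_weight_level finite_subset[OF _ finite_weight_level[OF S, of m]])
  have disj: "{x \<in> supported (S - {i}). weight x = m} \<inter> {x \<in> ?L m. 0 < x i} = {}"
    by (auto simp: supported_def)
  have "fps_nth (power_series S g) m = fps_nth (power_series (S - {i}) g) m
      + (\<Sum>x\<in>{x \<in> ?L m. 0 < x i}. \<pi> ^ g x)"
    unfolding power_series_def fps_nth_Abs_fps
    by (subst split, rule sum.union_disjoint[OF fin disj])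
  then show "fps_nth (power_series S g) m = fps_nth (power_series (S - {i}) g
    + fps_X ^ d i * power_series S (\<lambda>x. g (x(i := Suc (x i))))) m"
    unfolding shift by (simp add: fps_X_power_mult_nth) (simp add: power_series_def)
qed

lemma denominator_remove:
  assumes "S \<subseteq> {..<n}" "i \<in> S"
  shows "denominator S = euler_fps 0 (d i) * denominator (S - {i})"
  unfolding denominator_def using assms by (intro prod.remove) (auto intro: finite_subset)

text \<open>It is enough to treat a translate of \<open>g\<close>. By
  \<open>power_series_split\<close>, lowering one coordinate of \<open>y\<close> changes the series
  by a monomial factor and by a series without the variable \<open>i\<close>, which
  \<open>IH\<close> controls. Induction on the weight of \<open>y\<close> leads down to y =
  0.\<close>

lemma coeffs_bounded_shift:
  assumes r: "0 < r" and S: "S \<subseteq> {..<n}" and g: "monotone_sep_poly g"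
    and IH: "\<And>i g. i \<in> S \<Longrightarrow> monotone_sep_poly g \<Longrightarrow>
      coeffs_bounded r (power_series (S - {i}) g * denominator (S - {i}))"
    and y: "y \<in> supported S"
    and bd: "coeffs_bounded r (power_series S (\<lambda>x. g (\<lambda>j. x j + y j)) * denominator S)"
  shows "coeffs_bounded r (power_series S g * denominator S)"
  using y bd
proof (induction "weight y" arbitrary: y rule: less_induct)
  case less
  show ?case
  proof (cases "\<forall>i\<in>S. y i = 0")
    case True
    then have "y = (\<lambda>_. 0)" using less.prems(1) by (auto simp: supported_def)
    then show ?thesis using less.prems(2) by simp
  next
    case False
    then obtain i where i: "i \<in> S" "0 < y i" by auto
    then have "i < n" using S by auto
    define z where "z = y(i := y i - 1)"
    have y: "y = z(i := Suc (z i))" using i by (auto simp: z_def)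
    define h where "h = (\<lambda>x. g (\<lambda>j. x j + z j))"
    have "(\<lambda>x. g (\<lambda>j. x j + y j)) = (\<lambda>x. h (x(i := Suc (x i))))"
      unfolding h_def y by (intro ext arg_cong[of _ _ g]) auto
    then have "power_series S h * denominator S
        = euler_fps 0 (d i) * (power_series (S - {i}) h * denominator (S - {i}))
          + fps_const 1 * fps_X ^ d i * (power_series S (\<lambda>x. g (\<lambda>j. x j + y j)) * denominator S)"
      by (subst power_series_split[OF S i(1)])
        (simp add: denominator_remove[OF S i(1)] algebra_simps)
    moreover have "monotone_sep_poly h" unfolding h_def by (rule monotone_sep_poly_shift[OF g])
    ultimately have "coeffs_bounded r (power_series S h * denominator S)"
      using r entire_imp_coeffs_bounded[OF entire_euler_fps[OF weight_pos[OF \<open>i < n\<close>]] r]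
      by (simp only:) (intro coeffs_bounded_add coeffs_bounded_mult[OF _ IH[OF i(1)]]
          coeffs_bounded_mult[OF _ less.prems(2)] coeffs_bounded_monomial; simp)
    moreover have "weight z < weight y"
      unfolding y weight_upd[OF \<open>i < n\<close>] using weight_pos[OF \<open>i < n\<close>] by simp
    moreover have "z \<in> supported S" using less.prems(1) i(1) by (simp add: z_def supported_upd)
    ultimately show ?thesis using less.hyps[of z] by (simp add: h_def)
  qed
qed

text \<open>In degree \<open>m\<close> every summand has absolute value at most
  \<open>r ^ m\<close>, and so does their sum, however many there are.\<close>

lemma coeffs_bounded_of_growth:
  assumes r: "0 < r" "r \<le> 1" and c: "absp \<pi> ^ c \<le> r"
    and g: "\<And>x. x \<in> supported S \<Longrightarrow> c * weight x \<le> g x"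
  shows "coeffs_bounded r (power_series S g)"
proof -
  have "absp (fps_nth (power_series S g) m) \<le> 1 * r ^ m" for m
    unfolding power_series_def fps_nth_Abs_fps
  proof (rule absp_sum_le)
    fix x assume "x \<in> {x \<in> supported S. weight x = m}"
    then have "c * m \<le> g x" using g by auto
    then have "absp (\<pi> ^ g x) \<le> absp \<pi> ^ (c * m)"
      unfolding absp_power using pi_pos pi_less_1 by (intro power_decreasing) auto
    also have "\<dots> \<le> r ^ m" unfolding power_mult using c by (intro power_mono) (simp_all add: absp_nonneg)
    finally show "absp (\<pi> ^ g x) \<le> 1 * r ^ m" by simp
  qed (use r in simp)
  then show ?thesis unfolding coeffs_bounded_def by blast
qed

text \<open>The radius is fixed throughout, because the growth demanded in the second case depends
  on \<open>r\<close>; \<open>g\<close> varies, because the induction hypothesis is also applied to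
  translates.\<close>

lemma coeffs_bounded_power_series:
  assumes r: "0 < r" "r \<le> 1" and "S \<subseteq> {..<n}" "monotone_sep_poly g"
  shows "coeffs_bounded r (power_series S g * denominator S)"
  using finite_subset[OF assms(3) finite_lessThan] assms(3,4)
proof (induction S arbitrary: g rule: finite_psubset_induct)
  case (psubset S)
  note S = psubset.prems(1) and g = psubset.prems(2)
  have IH: "coeffs_bounded r (power_series (S - {i}) h * denominator (S - {i}))"
    if "i \<in> S" "monotone_sep_poly h" for i h
    using that S by (intro psubset.IH) auto
  show ?case
  proof (cases "\<exists>i\<in>S. \<exists>s. \<forall>y\<in>supported S. g (y(i := Suc (y i))) = g y + s")
    case True
    then obtain i s where i: "i \<in> S" and s: "\<And>y. y \<in> supported S \<Longrightarrow> g (y(i := Suc (y i))) = g y + s"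
      by blast
    have D: "0 < d i" using i S weight_pos by auto
    have "power_series S (\<lambda>x. g (x(i := Suc (x i)))) = fps_const (\<pi> ^ s) * power_series S g"
      by (rule fps_ext) (simp add: power_series_def s sum_distrib_left power_add mult.commute)
    with power_series_split[OF S i, of g]
    have eq: "power_series S g * (1 - fps_const (\<pi> ^ s) * fps_X ^ d i) = power_series (S - {i}) g"
      by (simp add: algebra_simps)
    \<comment> \<open>The Euler product with its factor of index \<open>s\<close> left out: that
      factor cancels the denominator of the geometric series.\<close>
    define k where "k = (\<Prod>j<s. 1 - fps_const (\<pi> ^ j) * fps_X ^ d i) * euler_fps (Suc s) (d i)"
    have k: "entire k"
      unfolding k_def by (intro entire_mult entire_prod entire_binomial entire_euler_fps D)
    have "euler_fps 0 (d i) = (1 - fps_const (\<pi> ^ s) * fps_X ^ d i) * k"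
      unfolding k_def euler_fps_split[OF D, of s] euler_fps_Suc[OF D, of s] by (simp only: mult_ac)
    then have "power_series S g * denominator S
        = (power_series S g * (1 - fps_const (\<pi> ^ s) * fps_X ^ d i)) * denominator (S - {i}) * k"
      by (simp only: denominator_remove[OF S i] mult_ac)
    also have "\<dots> = (power_series (S - {i}) g * denominator (S - {i})) * k" by (simp only: eq)
    finally show ?thesis
      using IH[OF i g] entire_imp_coeffs_bounded[OF k r(1)] r(1) by (simp add: coeffs_bounded_mult)
  next
    case False
    obtain c where c: "absp \<pi> ^ c \<le> r" using real_arch_pow_inv[OF r(1) pi_less_1] less_imp_le by blast
    \<comment> \<open>The weight of \<open>x\<close> is at most \<open>D\<close> times its largest
      coordinate, so growth \<open>c * D\<close> along the lines yields growth \<open>c\<close> in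
      the weight.\<close>
    define D where "D = (\<Sum>i<n. d i)"
    have "\<forall>i\<in>S. \<exists>y t0. y \<in> supported S \<and> (\<forall>t\<ge>t0. c * D * t \<le> g (y(i := t)))"
      using False monotone_sep_poly_slope[OF g psubset.hyps(1), of _ "c * D"] by blast
    then obtain Y t0 where Y: "\<And>i. i \<in> S \<Longrightarrow> Y i \<in> supported S"
      and t0: "\<And>i t. i \<in> S \<Longrightarrow> t0 i \<le> t \<Longrightarrow> c * D * t \<le> g ((Y i)(i := t))"
      by metis
    \<comment> \<open>This translation dominates all base points \<open>Y j\<close> and passes every
      threshold \<open>t0 j\<close>.\<close>
    define y where "y = (\<lambda>j. if j \<in> S then (\<Sum>i\<in>S. Y i j) + t0 j else 0)"
    have Yy: "Y i j \<le> y j" if "i \<in> S" for i j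
    proof (cases "j \<in> S")
      case True
      have "Y i j \<le> (\<Sum>i\<in>S. Y i j)" using that psubset.hyps(1) by (intro member_le_sum) auto
      then show ?thesis using True by (simp add: y_def)
    next
      case False
      then show ?thesis using Y[OF that] by (simp add: supported_def)
    qed
    have "c * weight x \<le> g (\<lambda>j. x j + y j)" if x: "x \<in> supported S" for x
    proof (cases "S = {}")
      case True
      then show ?thesis using x by (simp add: supported_def weight_def)
    next
      case False
      then have "Max (x ` S) \<in> x ` S" using psubset.hyps(1) by (intro Max_in) auto
      \<comment> \<open>The direction of the largest coordinate is used: the point of its fast line
        with coordinate \<open>x i + y i\<close> lies below the translate of \<open>x\<close>, so
        monotonicity transfers the growth.\<close>
      then obtain i where i: "i \<in> S" "Max (x ` S) = x i" by (rule imageE)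
      have max: "x j \<le> x i" for j
      proof (cases "j \<in> S")
        case True
        then show ?thesis unfolding i(2)[symmetric] using psubset.hyps(1) by (intro Max_ge) auto
      qed (use x in \<open>simp add: supported_def\<close>)
      have "weight x \<le> (\<Sum>j<n. d j * x i)" unfolding weight_def by (intro sum_mono mult_le_mono2 max)
      then have "weight x \<le> D * x i" by (simp add: D_def sum_distrib_right)
      then have "c * weight x \<le> c * (D * (x i + y i))" by (simp add: distrib_left trans_le_add1)
      also have "\<dots> \<le> g ((Y i)(i := x i + y i))"
        using t0[OF i(1), of "x i + y i"] i(1) by (simp add: y_def mult.assoc)
      also have "\<dots> \<le> g (\<lambda>j. x j + y j)"
      proof (rule monotone_sep_poly_mono[OF g psubset.hyps(1)])
        show "((Y i)(i := x i + y i)) j \<le> x j + y j" for j using Yy[OF i(1), of j] by auto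
        show "((Y i)(i := x i + y i)) j = x j + y j" if "j \<notin> S" for j
          using that i(1) Y[OF i(1)] x by (auto simp: supported_def y_def)
      qed
      finally show ?thesis .
    qed
    then have "coeffs_bounded r (power_series S (\<lambda>x. g (\<lambda>j. x j + y j)))"
      by (intro coeffs_bounded_of_growth[OF r c])
    then have "coeffs_bounded r (power_series S (\<lambda>x. g (\<lambda>j. x j + y j)) * denominator S)"
      using r(1) entire_imp_coeffs_bounded[OF entire_denominator[OF S] r(1)] by (simp add: coeffs_bounded_mult)
    moreover have "y \<in> supported S" by (simp add: supported_def y_def)
    ultimately show ?thesis using coeffs_bounded_shift[OF r(1) S g IH] by blast
  qed
qed

section \<open>Meromorphy and the field generated by the poles\<close>

lemma denominator_neq_0: "denominator S \<noteq> 0"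
proof (cases "finite S")
  case True
  have "euler_fps 0 D \<noteq> 0" for D using euler_fps_nth_0[of 0 D] by auto
  then show ?thesis using True by (simp add: denominator_def)
qed (simp add: denominator_def)

lemma entire_quotient_power_series:
  assumes "S \<subseteq> {..<n}" "monotone_sep_poly g"
  shows "entire_quotient (power_series S g) (power_series S g * denominator S) (denominator S)"
  unfolding entire_quotient_def
  using assms by (simp add: entireI coeffs_bounded_power_series entire_denominator denominator_neq_0)

lemma denominator_zero:
  assumes "S \<subseteq> {..<n}" "fps_value (denominator S) a = 0"
  shows "\<exists>i\<in>S. \<exists>j. \<pi> ^ j * a ^ d i = 1"
proof -
  have S: "finite S" "\<And>i. i \<in> S \<Longrightarrow> 0 < d i" using assms(1) weight_pos finite_subset by auto
  have "(\<Prod>i\<in>S. fps_value (euler_fps 0 (d i)) a) = 0"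
    using assms(2) S unfolding denominator_def by (subst (asm) fps_value_prod) (auto intro: entire_euler_fps)
  then obtain i where "i \<in> S" "fps_value (euler_fps 0 (d i)) a = 0" using S(1) by auto
  then show ?thesis using euler_fps_zero[OF S(2)] by blast
qed

lemma finite_extension_poles:
  fixes F :: "'a fps"
  assumes N: "0 < N" and q: "\<pi> ^ N \<in> Qp"
    and F: "entire_quotient F G (denominator {..<n})"
  shows "finite_extension Qp (adjoin Qp (poles F))"
proof -
  \<comment> \<open>Up to powers of \<pi>, each pole is one of these finitely many roots, since the
    exponent of \<pi> may be reduced modulo \<open>d i\<close>.\<close>
  define A where "A = insert \<pi> (\<Union>i<n. \<Union>m<d i. {a. \<pi> ^ m * a ^ d i = 1})"
  note Qp = is_subfieldD[OF is_subfield_Qp]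
  have pi0: "\<pi> \<noteq> 0" using pi_pos by auto
  show ?thesis
  proof (rule finite_extension_adjoin_radicals[OF is_subfield_Qp])
    have "finite {a. \<pi> ^ m * a ^ d i = 1}" if "i < n" for i m
    proof -
      let ?P = "monom (\<pi> ^ m) (d i) - 1"
      have "coeff ?P (d i) \<noteq> 0" using pi0 weight_pos[OF that] by simp
      then have "?P \<noteq> 0" by (metis coeff_0)
      from poly_roots_finite[OF this] show ?thesis by (simp add: poly_monom)
    qed
    then show "finite A" by (auto simp: A_def)
  next
    fix a assume "a \<in> A"
    then consider "a = \<pi>" | i m where "i < n" "\<pi> ^ m * a ^ d i = 1" by (auto simp: A_def)
    then show "\<exists>e>0. a ^ e \<in> Qp"
    proof cases
      case 1
      then show ?thesis using N q by blast
    next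
      case 2
      \<comment> \<open>Only \<pi>^N is known to lie in \<open>Qp\<close>, so the relation is raised
        to the power \<open>N\<close>.\<close>
      have "(\<pi> ^ N) ^ m * a ^ (d i * N) = (\<pi> ^ m * a ^ d i) ^ N"
        by (simp add: power_mult_distrib mult.commute flip: power_mult)
      also have "\<dots> = 1" by (simp add: 2(2))
      finally have "a ^ (d i * N) = inverse ((\<pi> ^ N) ^ m)" by (simp add: inverse_unique)
      then have "a ^ (d i * N) \<in> Qp" using Qp(6) is_subfield_power[OF is_subfield_Qp q] by simp
      moreover have "0 < d i * N" using N weight_pos[OF 2(1)] by simp
      ultimately show ?thesis by blast
    qed
  next
    fix L :: "'a set" assume L: "is_subfield L" and AL: "A \<subseteq> L"
    note LD = is_subfieldD[OF L]
    show "poles F \<subseteq> L"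
    proof
      fix a assume "a \<in> poles F"
      then have "fps_value (denominator {..<n}) a = 0" by (rule fps_value_pole[OF F])
      then obtain i j where i: "i < n" and j: "\<pi> ^ j * a ^ d i = 1"
        using denominator_zero[of "{..<n}" a] by auto
      define l where "l = j div d i"
      have "\<pi> ^ j = \<pi> ^ (j mod d i) * (\<pi> ^ l) ^ d i"
        unfolding l_def power_mult[symmetric] power_add[symmetric] by (simp add: mult.commute)
      then have "\<pi> ^ (j mod d i) * (a * \<pi> ^ l) ^ d i = \<pi> ^ j * a ^ d i"
        by (simp add: power_mult_distrib mult_ac)
      then have "a * \<pi> ^ l \<in> A"
        using i j weight_pos[OF i] unfolding A_def
        by (intro insertI2 UN_I[of i] UN_I[of "j mod d i"]) auto
      moreover have "\<pi> \<in> A" by (simp add: A_def)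
      ultimately have "a * \<pi> ^ l * inverse (\<pi> ^ l) \<in> L"
        using AL LD(4,6) is_subfield_power[OF L] by blast
      then show "a \<in> L" using pi0 by (simp add: mult.assoc)
    qed
  qed
qed

end


subsection \<open>Increasing polynomials\<close>

lemma mpoly_eval_line:
  "\<exists>u :: real poly. \<forall>t. of_rat (mpoly_eval f (y(i := t))) = poly u (real t)"
proof -
  define u where "u = (\<Sum>m\<in>Poly_Mapping.keys f. smult (of_rat (Poly_Mapping.lookup f m))
    (\<Prod>j\<in>Poly_Mapping.keys m. (if j = i then [:0, 1:] else [:real (y j):]) ^ Poly_Mapping.lookup m j))"
  have "of_rat (mpoly_eval f (y(i := t))) = poly u (real t)" for t
    unfolding mpoly_eval_def u_def poly_sum poly_smult poly_prod poly_power of_rat_sum of_rat_mult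
      of_rat_prod of_rat_power of_rat_of_nat_eq
    by (intro sum.cong prod.cong refl arg_cong2[of _ _ _ _ "(*)"] arg_cong2[of _ _ _ _ "(^)"]) auto
  then show ?thesis by blast
qed

text \<open>The denominators of the finitely many coefficients are multiplied together; the
  monomials take integer values.\<close>

lemma mpoly_eval_common_denominator:
  obtains N :: nat where "0 < N" "\<And>x. of_nat N * mpoly_eval f x \<in> \<int>"
proof -
  have "\<exists>N::nat. 0 < N \<and> (\<forall>r\<in>B. of_nat N * r \<in> \<int>)" if "finite B" for B :: "rat set"
    using that
  proof (induction B)
    case (insert r B)
    then obtain N :: nat where N: "0 < N" "\<And>r. r \<in> B \<Longrightarrow> of_nat N * r \<in> \<int>" by blast
    obtain a b where r: "r = of_int a / of_int b" "b > 0"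
      by (cases r) (auto simp: Fract_of_int_quotient)
    have "of_nat (nat b) * r = of_int a" using r by simp
    then have "of_nat (N * nat b) * r = of_int (int N * a)" by (simp add: mult.assoc)
    moreover have "of_nat (N * nat b) * s \<in> \<int>" if "s \<in> B" for s
    proof -
      have "of_nat (N * nat b) * s = of_nat (nat b) * (of_nat N * s)" by (simp add: mult_ac)
      then show ?thesis using N(2)[OF that] by (simp only: Ints_mult Ints_of_nat)
    qed
    ultimately show ?case using N(1) r(2)
      by (intro exI[of _ "N * nat b"]) (auto simp only: ball_simps Ints_of_int nat_0_less_mult_iff zero_less_nat_eq)
  qed (auto intro: exI[of _ 1])
  from this[of "Poly_Mapping.lookup f ` Poly_Mapping.keys f"]
  obtain N :: nat where N: "0 < N" "\<And>m. m \<in> Poly_Mapping.keys f \<Longrightarrow> of_nat N * Poly_Mapping.lookup f m \<in> \<int>"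
    by auto
  have "of_nat N * mpoly_eval f x \<in> \<int>" for x
    unfolding mpoly_eval_def sum_distrib_left mult.assoc[symmetric]
    by (intro Ints_sum Ints_mult N(2) Ints_prod Ints_power Ints_of_nat)
  then show thesis using that N(1) by blast
qed

text \<open>Unit steps lead from \<open>x\<close> down to the origin. This is what makes N (f -
  f(0)) take values in the natural numbers.\<close>

lemma increasing_poly_ge_0:
  assumes f: "increasing_poly n f" and x: "x \<in> nat_vectors n"
  shows "mpoly_eval f (\<lambda>_. 0) \<le> mpoly_eval f x"
  using x
proof (induction "\<Sum>i<n. x i" arbitrary: x rule: less_induct)
  case less
  show ?case
  proof (cases "\<exists>i<n. 0 < x i")
    case True
    then obtain i where i: "i < n" "0 < x i" by blast
    define z where "z = x(i := x i - 1)"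
    have z: "z \<in> nat_vectors n" using less.prems i by (auto simp: z_def nat_vectors_def)
    have "x = z(i := z i + 1)" using i(2) by (auto simp: z_def)
    then have "mpoly_eval f z \<le> mpoly_eval f x"
      using f z i(1) unfolding increasing_poly_def by metis
    moreover have "(\<Sum>j<n. z j) < (\<Sum>j<n. x j)"
      using i by (intro sum_strict_mono_ex1) (auto simp: z_def)
    ultimately show ?thesis using less.hyps[OF _ z] by linarith
  next
    case False
    then have "x = (\<lambda>_. 0)" using less.prems by (auto simp: nat_vectors_def not_less[symmetric])
    then show ?thesis by simp
  qed
qed

lemma increasing_poly_normalise:
  assumes f: "increasing_poly n f"
  obtains N :: nat and g where "0 < N" "monotone_sep_poly g"
    "\<And>x. x \<in> nat_vectors n \<Longrightarrow> mpoly_eval f x = mpoly_eval f (\<lambda>_. 0) + of_nat (g x) * (1 / of_nat N)"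
proof -
  obtain N :: nat where N: "0 < N" "\<And>x. of_nat N * mpoly_eval f x \<in> \<int>"
    using mpoly_eval_common_denominator by blast
  \<comment> \<open>The hypothesis on \<open>f\<close> concerns vectors in
    \<open>nat_vectors n\<close>, while \<open>monotone_sep_poly\<close> ranges over all vectors.
    Discarding the coordinates from \<open>n\<close> on makes the function constant in those
    directions.\<close>
  define e where "e = (\<lambda>x. mpoly_eval f (\<lambda>i. if i < n then x i else 0))"
  define g where "g = (\<lambda>x. nat \<lfloor>of_nat N * (e x - mpoly_eval f (\<lambda>_. 0))\<rfloor>)"
  have g: "of_nat (g x) = of_nat N * (e x - mpoly_eval f (\<lambda>_. 0))" for x
  proof -
    have "mpoly_eval f (\<lambda>_. 0) \<le> e x"
      unfolding e_def by (intro increasing_poly_ge_0[OF f]) (simp add: nat_vectors_def)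
    then have "0 \<le> of_nat N * (e x - mpoly_eval f (\<lambda>_. 0))" by simp
    moreover have "of_nat N * (e x - mpoly_eval f (\<lambda>_. 0)) \<in> \<int>"
      unfolding right_diff_distrib e_def by (intro Ints_diff N)
    ultimately show ?thesis unfolding g_def by (auto elim!: Ints_cases)
  qed
  have "monotone_sep_poly g"
    unfolding monotone_sep_poly_def
  proof (intro conjI allI)
    fix i and y :: "nat \<Rightarrow> nat"
    have upd: "(\<lambda>j. if j < n then (y(i := t)) j else 0) =
      (if i < n then (\<lambda>j. if j < n then y j else 0)(i := t) else (\<lambda>j. if j < n then y j else 0))" for t
      by auto
    have "e y \<le> e (y(i := Suc (y i)))"
    proof (cases "i < n")
      case True
      have "(\<lambda>j. if j < n then y j else 0) \<in> nat_vectors n" by (simp add: nat_vectors_def)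
      then show ?thesis
        using f True unfolding e_def upd increasing_poly_def by fastforce
    qed (simp add: e_def upd)
    then have "(of_nat (g y) :: rat) \<le> of_nat (g (y(i := Suc (y i))))"
      unfolding g by (intro mult_left_mono) auto
    then show "g y \<le> g (y(i := Suc (y i)))" by simp
    obtain u :: "real poly" where u: "\<And>t. of_rat (e (y(i := t))) = poly u (real t)"
    proof (cases "i < n")
      case True
      then show thesis
        using that mpoly_eval_line[of f "\<lambda>j. if j < n then y j else 0" i] unfolding e_def upd by auto
    next
      case False
      then show thesis using that[of "[:of_rat (e y):]"] by (simp add: e_def upd)
    qed
    have "real (g (y(i := t))) = poly (smult (real N) (u - [:of_rat (mpoly_eval f (\<lambda>_. 0)):])) (real t)" for t
    proof -
      have "real (g (y(i := t))) = of_rat (of_nat (g (y(i := t))))" by simp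
      also have "\<dots> = real N * (poly u (real t) - of_rat (mpoly_eval f (\<lambda>_. 0)))"
        unfolding g by (simp add: of_rat_mult of_rat_diff u)
      finally show ?thesis by simp
    qed
    then show "\<exists>u. \<forall>t. real (g (y(i := t))) = poly u (real t)" by blast
  qed
  moreover have "mpoly_eval f x = mpoly_eval f (\<lambda>_. 0) + of_nat (g x) * (1 / of_nat N)"
    if "x \<in> nat_vectors n" for x
  proof -
    have "(\<lambda>i. if i < n then x i else 0) = x" using that by (auto simp: nat_vectors_def)
    then have "e x = mpoly_eval f x" by (simp add: e_def)
    then show ?thesis using N(1) by (simp add: g)
  qed
  ultimately show thesis using that N(1) by blast
qed

section \<open>From rational powers of \<open>q\<close> to powers of \<pi>\<close>

theorem theorem4p2:
  fixes p q k n :: nat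
    and absp :: "'a::{field_char_0,complete_space} \<Rightarrow> real"
    and pw :: "rat \<Rightarrow> 'a"
    and f :: rat_mpoly
    and d :: "nat \<Rightarrow> nat"
  assumes "padic_complex_field p absp"
    and "prime p"
    and "k \<ge> 1" and "q = p ^ k"
    and "rational_powers (of_nat q) pw"
    and "in_vars n f"
    and "increasing_poly n f"
    and "\<And>i. i < n \<Longrightarrow> d i > 0"
  shows "padic_meromorphic (gen_series pw n f d) \<and>
         finite_extension Qp (adjoin Qp (poles (gen_series pw n f d)))"
proof -
  interpret padic_complex_field p absp by (rule assms(1))
  obtain N :: nat and g where N: "0 < N" and g: "monotone_sep_poly g"
    and fg: "\<And>x. x \<in> nat_vectors n \<Longrightarrow>
      mpoly_eval f x = mpoly_eval f (\<lambda>_. 0) + of_nat (g x) * (1 / of_nat N)"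
    using increasing_poly_normalise[OF assms(7)] by blast
  have p: "1 < real p" using prime_gt_1_nat[OF assms(2)] by simp
  have q0: "(of_nat q :: 'a) \<noteq> 0" using p assms(4) by simp
  have pw_add: "pw (a + b) = pw a * pw b" and pw_1: "pw 1 = of_nat q" for a b
    using assms(5) by (auto simp: rational_powers_def)
  have pw_0: "pw 0 = 1" using rational_powers_of_int[OF assms(5) q0, of 0] by simp
  have pw_mult: "pw (of_nat j * r) = pw r ^ j" for j r
    by (induction j) (simp_all add: pw_0 pw_add distrib_right)
  \<comment> \<open>The homomorphism \<open>pw\<close> selects this root of \<open>q\<close>; its
    values at multiples of 1/N are then powers of \<pi>.\<close>
  define \<pi> where "\<pi> = pw (1 / of_nat N)"
  have pi_N: "\<pi> ^ N = of_nat q"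
    unfolding \<pi>_def pw_mult[symmetric] using N by (simp add: pw_1)
  \<comment> \<open>As k \<ge> 1, the right side is below 1, which places \<pi> in the open unit
    disc.\<close>
  have abs_pi: "absp \<pi> ^ N = (1 / real p) ^ k"
    by (simp add: absp_power[symmetric] pi_N assms(4)) (simp add: absp_power absp_p power_one_over)
  interpret padic_weighted p absp \<pi> n d
  proof
    have "\<pi> \<noteq> 0" using pi_N q0 N by (auto simp: power_0_left)
    then show "0 < absp \<pi>" by (rule absp_pos)
    have "(1 / real p) ^ k \<le> (1 / real p) ^ 1" using p assms(3) by (intro power_decreasing) auto
    also have "\<dots> < 1" using p by simp
    finally have "(1 / real p) ^ k < 1" .
    then show "absp \<pi> < 1" using abs_pi one_le_power[of "absp \<pi>" N] by linarith
  qed (rule assms(8))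
  let ?F = "gen_series pw n f d" and ?c = "pw (mpoly_eval f (\<lambda>_. 0))"
    and ?P = "power_series {..<n} g" and ?H = "denominator {..<n}"
  have supp: "nat_vectors n = supported {..<n}" by (auto simp: nat_vectors_def supported_def)
  have "pw (mpoly_eval f x) = ?c * \<pi> ^ g x" if "x \<in> nat_vectors n" for x
    unfolding fg[OF that] pw_add pw_mult \<pi>_def ..
  then have F: "?F = fps_const ?c * ?P"
    by (intro fps_ext) (simp add: gen_series_def power_series_def sum_distrib_left supp weight_def)
  have "entire (fps_const ?c)"
    using coeffs_bounded_monomial[of _ ?c 0] by (intro entireI) simp
  then have quot: "entire_quotient ?F (fps_const ?c * (?P * ?H)) ?H"
    using entire_quotient_power_series[OF order_refl g] entire_mult
    by (auto simp: entire_quotient_def F mult.assoc)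
  have "(of_nat q :: 'a) \<in> Qp" unfolding Qp_def using closure_subset by (rule subsetD) simp
  then have "finite_extension Qp (adjoin Qp (poles ?F))"
    using finite_extension_poles[OF N _ quot] by (simp add: pi_N)
  moreover have "padic_meromorphic ?F" using quot by (auto simp: padic_meromorphic_def)
  ultimately show ?thesis by blast
qed

end
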